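(* Let $\delta>0$ and set $D=(-1,1)^2$ and $D_0=(-\delta,\delta)^2$. The following are equivalent. (a) There is a nonzero $u\in C_c^\infty(D)$ such that $\mathcal R u(\omega,p)=0$ for all $(\omega,p)\in\mathbb S^1\times\mathbb R$ with $L(\omega,p)\cap D_0\neq\varnothing$. (b) There is a nonzero $u\in L^1(\mathbb R^2)$ with $\operatorname{supp}u\Subset D$ such that $\mathcal R u(\omega,p)=0$ for almost every $(\omega,p)\in\mathbb S^1\times\mathbb R$ with $L(\omega,p)\cap D_0\neq\varnothing$. (c) $\delta<\dfrac1{\sqrt2}$.
   Context: Functions are complex-valued. $\mathbb S^1=\{\omega\in\mathbb R^2:|\omega|=1\}$ carries arc-length measure $d\omega$, and $\mathbb S^1\times\mathbb R$ carries the product measure $d\omega\,dp$ ("almost every" refers to this measure). For $\omega=(\omega_1,\omega_2)$ put $\omega^\perp=(-\omega_2,\omega_1)$. For $\omega\in\mathbb S^1$, $p\in\mathbb R$, let $L(\omega,p)=\{x\in\mathbb R^2:x\cdot\omega=p\}$ and $\mathcal R u(\omega,p)=\int_{L(\omega,p)}u\,ds$, where $ds$ is Euclidean arc length. If $u\in L^1(\mathbb R^2)$, Fubini's theorem in the coordinates $x=p\omega+t\omega^\perp$ defines $\mathcal R u$ as an $L^1(\mathbb S^1\times\mathbb R)$-class. For $u\in L^1(\mathbb R^2)$, $\operatorname{supp}u$ is the complement of the largest open set on which $u=0$ almost everywhere (for continuous $u$ this is the usual closed support). Write $\Omega_0\Subset\Omega_1$ if $\overline{\Omega_0}$ is compact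 and contained in $\Omega_1$. $C_c^\infty(D)=\{u\in C^\infty(\mathbb R^2):\operatorname{supp}u\Subset D\}$. *)

theory Defs
  imports "HOL-Analysis.Analysis"
begin

definition open_square :: "real \<Rightarrow> (real^2) set" where
  "open_square r = {x. \<forall>i. - r < x $ i \<and> x $ i < r}"

definition compactly_inside :: "'a::topological_space set \<Rightarrow> 'a set \<Rightarrow> bool"
  (infix "\<Subset>" 50) where
  "A \<Subset> B \<longleftrightarrow> compact (closure A) \<and> closure A \<subseteq> B"

(* Complement of the largest open set on which u vanishes almost everywhere; the union below
   is itself such a set because the topology has a countable base. *)
definition supp :: "(real^2 \<Rightarrow> complex) \<Rightarrow> (real^2) set" where
  "supp u = - \<Union>{U. open U \<and> (AE x in lborel. x \<in> U \<longrightarrow> u x = 0)}"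

(* Real differentiability of class C^k, through iterated directional derivatives. In finite
   dimension this is continuity of all derivatives up to order k. *)
primrec Ck :: "nat \<Rightarrow> ('a::euclidean_space \<Rightarrow> 'b::real_normed_vector) \<Rightarrow> bool" where
  "Ck 0 f \<longleftrightarrow> continuous_on UNIV f"
| "Ck (Suc k) f \<longleftrightarrow>
     (\<forall>x. f differentiable (at x)) \<and> (\<forall>v. Ck k (\<lambda>x. frechet_derivative f (at x) v))"

definition smooth :: "('a::euclidean_space \<Rightarrow> 'b::real_normed_vector) \<Rightarrow> bool" where
  "smooth f \<longleftrightarrow> (\<forall>k. Ck k f)"

definition Cc_infty :: "(real^2) set \<Rightarrow> (real^2 \<Rightarrow> complex) set" where
  "Cc_infty D = {u. smooth u \<and> supp u \<Subset> D}"

definition perp :: "real^2 \<Rightarrow> real^2" where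
  "perp w = vector [- (w $ 2), w $ 1]"

definition line :: "real^2 \<Rightarrow> real \<Rightarrow> (real^2) set" where
  "line w p = {x. x \<bullet> w = p}"

(* For w on the unit circle, t \<mapsto> p w + t w\<^sup>\<bottom> is a unit-speed parametrization
   of line w p, so this is the integral with respect to arc length. *)
definition radon :: "(real^2 \<Rightarrow> complex) \<Rightarrow> real^2 \<Rightarrow> real \<Rightarrow> complex" where
  "radon u w p = (LINT t|lborel. u (p *\<^sub>R w + t *\<^sub>R perp w))"

definition circle_point :: "real \<Rightarrow> real^2" where
  "circle_point \<theta> = vector [cos \<theta>, sin \<theta>]"

definition arc_length_measure :: "(real^2) measure" where
  "arc_length_measure =
     distr (restrict_space lborel {0..<2 * pi}) (restrict_space borel (sphere 0 1)) circle_point"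

lemma circle_point_in_sphere: "circle_point \<theta> \<in> sphere 0 1"
  by (simp add: circle_point_def norm_vec_def L2_set_def sum_2)

lemma circle_point_measurable:
  "circle_point \<in> restrict_space lborel {0..<2 * pi} \<rightarrow>\<^sub>M restrict_space borel (sphere 0 1)"
proof -
  have eq: "circle_point = (\<lambda>\<theta>. cos \<theta> *\<^sub>R axis 1 1 + sin \<theta> *\<^sub>R axis 2 1)"
    by (auto simp: fun_eq_iff circle_point_def vec_eq_iff forall_2 axis_def)
  have "continuous_on UNIV circle_point"
    unfolding eq by (intro continuous_intros)
  then have "circle_point \<in> borel_measurable lborel"
    by (simp add: borel_measurable_continuous_onI)
  then show ?thesis
    using circle_point_in_sphere
    by (intro measurable_restrict_space1 measurable_restrict_space2) auto
qed

lemma emeasure_arc_length_measure: "emeasure arc_length_measure (sphere 0 1) = ennreal (2 * pi)"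
proof -
  have "emeasure arc_length_measure (sphere 0 1) =
      emeasure (restrict_space lborel {0..<2 * pi})
        (circle_point -` sphere 0 1 \<inter> space (restrict_space lborel {0..<2 * pi}))"
    unfolding arc_length_measure_def
    by (intro emeasure_distr circle_point_measurable) (simp add: sets_restrict_space_iff)
  also have "circle_point -` sphere 0 1 \<inter> space (restrict_space lborel {0..<2 * pi}) = {0..<2 * pi}"
    using circle_point_in_sphere by (auto simp: space_restrict_space)
  also have "emeasure (restrict_space lborel {0..<2 * pi}) {0..<2 * pi} = ennreal (2 * pi)"
    by (subst emeasure_restrict_space) auto
  finally show ?thesis .
qed

lemma line_eq_range:
  assumes "w \<in> sphere 0 1"
  shows "line w p = range (\<lambda>t. p *\<^sub>R w + t *\<^sub>R perp w)"
proof -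
  have n: "w $ 1 * w $ 1 + w $ 2 * w $ 2 = 1"
    using assms by (simp add: norm_vec_def L2_set_def sum_2 power2_eq_square)
  have "x = p *\<^sub>R w + (x \<bullet> perp w) *\<^sub>R perp w" if "x \<bullet> w = p" for x
  proof -
    have p: "x $ 1 * w $ 1 + x $ 2 * w $ 2 = p"
      using that by (simp add: inner_vec_def sum_2)
    have "x $ 1 = p * w $ 1 + (x $ 2 * w $ 1 - x $ 1 * w $ 2) * (- (w $ 2))"
      "x $ 2 = p * w $ 2 + (x $ 2 * w $ 1 - x $ 1 * w $ 2) * w $ 1"
      using n p by algebra+
    then show ?thesis
      by (simp add: vec_eq_iff forall_2 perp_def inner_vec_def sum_2)
  qed
  moreover have "(p *\<^sub>R w + t *\<^sub>R perp w) \<bullet> w = p" for t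
    using n by (simp add: inner_vec_def sum_2 perp_def) algebra
  ultimately show ?thesis
    unfolding line_def by blast
qed

lemma supp_continuous:
  assumes "continuous_on UNIV u"
  shows "supp u = closure {x. u x \<noteq> 0}"
proof -
  have "(AE x in lborel. x \<in> U \<longrightarrow> u x = 0) \<longleftrightarrow> (\<forall>x\<in>U. u x = 0)" if "open U" for U
  proof
    assume ae: "AE x in lborel. x \<in> U \<longrightarrow> u x = 0"
    have "open {x \<in> U. u x \<noteq> 0}"
    proof -
      have "open (u -` (- {0}))"
        using assms by (intro open_vimage) auto
      then have "open (U \<inter> u -` (- {0}))"
        using that by blast
      moreover have "U \<inter> u -` (- {0}) = {x \<in> U. u x \<noteq> 0}" by auto
      ultimately show ?thesis by simp
    qed
    moreover have "{x \<in> U. u x \<noteq> 0} \<in> null_sets lborel"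
      using ae \<open>open {x \<in> U. u x \<noteq> 0}\<close> by (subst AE_iff_null_sets) (auto elim: eventually_mono)
    ultimately have "{x \<in> U. u x \<noteq> 0} = {}"
      using open_not_negligible negligible_iff_null_sets null_sets_completionI by blast
    then show "\<forall>x\<in>U. u x = 0" by auto
  qed auto
  then have "\<Union>{U. open U \<and> (AE x in lborel. x \<in> U \<longrightarrow> u x = 0)} = interior {x. u x = 0}"
    unfolding interior_def by (auto simp: subset_iff)
  then show ?thesis
    by (simp add: supp_def closure_interior Collect_neg_eq)
qed

end

(* Write x in the plane as a complex number, zeta = exp (2 i theta), and
   Y = (x + cnj x * zeta) / 2 = exp (i theta) (x . omega) on the circle |zeta| = 1.

   Uniqueness (delta >= 1 / sqrt 2, support in the square of half-side kappa < 1).  The moments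
   M_k(zeta) = int u Y^k are polynomials in zeta, and on the circle they are moments of the Radon
   data, which live on p^2 in the interval from (1 + |sin 2 theta|) / 2 to
   kappa^2 (1 + |sin 2 theta|).  There are polynomials a, h with |a(0)| > 1, h(0) = 0 and
   |a(zeta) + h(zeta) Y^2| <= 1 over all these intervals; they witness that no ellipse (that is, no
   real trigonometric polynomial alpha + Re (beta zeta) in place of p^2) fits between the two
   squares.  Hence int u (a + h Y^2)^N Y^k stays bounded on the circle as N grows, while its lowest
   coefficient is multiplied by a(0) at each step.  So every moment vanishes, and u = 0 by
   Stone-Weierstrass.

   Existence (delta < 1 / sqrt 2).  A disc fits between the squares; for f supported in
   (2 delta^2, 1), the radial function u(x) = int f(|x|^2 + t^2) dt has Radon transform
   pi int f at every |p| <= sqrt 2 delta, which is zero as soon as f has mean zero. *)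
theory Submission
  imports Defs "HOL-Complex_Analysis.Conformal_Mappings" "HOL-Computational_Algebra.Polynomial"
begin

section \<open>Coordinates along the lines in a fixed direction\<close>

definition line_coords :: "real^2 \<Rightarrow> real \<times> real \<Rightarrow> real^2" where
  "line_coords w = (\<lambda>(p, t). p *\<^sub>R w + t *\<^sub>R perp w)"

lemma perp_components: "perp w $ 1 = - (w $ 2)" "perp w $ 2 = w $ 1"
  by (simp_all add: perp_def)

lemma inner_vec2: "x \<bullet> y = x $ 1 * y $ 1 + x $ 2 * (y :: real^2) $ 2"
  by (simp add: inner_vec_def sum_2)

lemma sphere_vec2: "w \<in> sphere 0 1 \<longleftrightarrow> (w $ 1)\<^sup>2 + (w $ 2)\<^sup>2 = (1 :: real)" for w :: "real^2"
  by (simp add: norm_vec_def L2_set_def sum_2)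

lemma line_coords_inner:
  assumes "w \<in> sphere 0 1"
  shows "line_coords w (p, t) \<bullet> w = p"
  using assms unfolding sphere_vec2
  by (simp add: line_coords_def inner_vec2 perp_components algebra_simps power2_eq_square
      flip: distrib_left)

lemma continuous_on_line_coords: "continuous_on A (line_coords w)"
  unfolding line_coords_def case_prod_beta by (intro continuous_intros)

lemma measurable_line_coords [measurable]: "line_coords w \<in> borel_measurable borel"
  by (intro borel_measurable_continuous_onI continuous_on_line_coords)

lemma line_coords_inverse:
  assumes "w \<in> sphere 0 1"
  shows "line_coords w (x \<bullet> w, x \<bullet> perp w) = x"
proof -
  have "w $ 1 * w $ 1 + w $ 2 * w $ 2 = 1"
    using assms unfolding sphere_vec2 by (simp add: power2_eq_square)
  then have "(x $ 1 * w $ 1 + x $ 2 * w $ 2) * w $ 1 - (- x $ 1 * w $ 2 + x $ 2 * w $ 1) * w $ 2 = x $ 1"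
    "(x $ 1 * w $ 1 + x $ 2 * w $ 2) * w $ 2 + (- x $ 1 * w $ 2 + x $ 2 * w $ 1) * w $ 1 = x $ 2"
    by algebra+
  then show ?thesis
    by (simp add: line_coords_def vec_eq_iff forall_2 inner_vec2 perp_components)
qed

lemma line_coords_axis: "line_coords (axis 1 1) (a, b) = vector [a, b]"
  by (simp add: line_coords_def vec_eq_iff forall_2 perp_components axis_def)

section \<open>Invariance of Lebesgue measure and Fubini along lines\<close>

text \<open>Lebesgue measure is determined by its values on boxes, and this identification pulls a
  box back to the box with the same side lengths.\<close>

lemma distr_lborel_vector: "distr (lborel :: (real \<times> real) measure) borel (\<lambda>(a, b). vector [a, b] :: real^2) = lborel"
proof (rule lborel_eqI[symmetric])
  have meas: "(\<lambda>(a, b). vector [a, b] :: real^2) \<in> borel_measurable borel"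
    using measurable_line_coords[of "axis 1 1"]
    by (simp add: line_coords_axis[symmetric] case_prod_beta cong: measurable_cong)
  fix l u :: "real^2"
  assume le: "\<And>b. b \<in> Basis \<Longrightarrow> l \<bullet> b \<le> u \<bullet> b"
  have le': "l $ i \<le> u $ i" for i
    using le[of "axis i 1"] by (simp add: inner_axis axis_in_Basis_iff)
  have "(\<lambda>(a, b). vector [a, b] :: real^2) -` box l u = box (l $ 1, l $ 2) (u $ 1, u $ 2)"
    by (auto simp: mem_box_cart forall_2 mem_box Basis_prod_def)
  then have "emeasure (distr (lborel :: (real \<times> real) measure) borel (\<lambda>(a, b). vector [a, b] :: real^2)) (box l u)
      = emeasure lborel (box (l $ 1, l $ 2) (u $ 1, u $ 2))"
    using meas by (subst emeasure_distr) auto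
  also have "\<dots> = ennreal (\<Prod>b\<in>Basis. ((u $ 1, u $ 2) - (l $ 1, l $ 2)) \<bullet> b)"
    using le' by (intro emeasure_lborel_box) (auto simp: Basis_prod_def)
  also have "(\<Prod>b\<in>Basis. ((u $ 1, u $ 2) - (l $ 1, l $ 2)) \<bullet> b) = (u $ 1 - l $ 1) * (u $ 2 - l $ 2)"
    by (simp add: Basis_prod_def)
  also have "\<dots> = (\<Prod>b\<in>Basis. (u - l) \<bullet> b)"
  proof -
    have Basis_eq: "(Basis :: (real^2) set) = {axis 1 1, axis 2 1}"
      by (auto simp: Basis_vec_def UNIV_2)
    have "axis 1 1 \<noteq> (axis 2 1 :: real^2)"
      by (simp add: axis_eq_axis)
    then show ?thesis
      unfolding Basis_eq by (simp add: inner_axis)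
  qed
  finally show "emeasure (distr (lborel :: (real \<times> real) measure) borel (\<lambda>(a, b). vector [a, b] :: real^2)) (box l u)
      = ennreal (\<Prod>b\<in>Basis. (u - l) \<bullet> b)" .
qed simp

text \<open>The map is a rotation, so the preimage of a box is its image under the inverse
  \<open>g\<close>, and orthogonal transformations preserve Lebesgue measure.\<close>

lemma distr_lborel_rotation:
  assumes "w \<in> sphere 0 1"
  shows "distr lborel borel (\<lambda>x::real^2. line_coords w (x $ 1, x $ 2)) = (lborel :: (real^2) measure)"
proof (rule lborel_eqI[symmetric])
  fix l u :: "real^2"
  assume le: "\<And>b. b \<in> Basis \<Longrightarrow> l \<bullet> b \<le> u \<bullet> b"
  define f where "f x = line_coords w (x $ 1, x $ 2)" for x :: "real^2"
  define g where "g x = (vector [x \<bullet> w, x \<bullet> perp w] :: real^2)" for x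
  have n: "w $ 1 * w $ 1 + w $ 2 * w $ 2 = 1"
    using assms unfolding sphere_vec2 by (simp add: power2_eq_square)
  have fg: "f (g x) = x" for x
    using line_coords_inverse[OF assms] by (simp add: f_def g_def)
  have "orthogonal_transformation g"
    unfolding orthogonal_transformation
  proof
    show "linear g"
      by (intro linearI) (simp_all add: g_def vec_eq_iff forall_2 inner_left_distrib)
    have "norm (g x) = norm x" for x
    proof -
      have "(x $ 1 * w $ 1 + x $ 2 * w $ 2)\<^sup>2 + (- (x $ 1 * w $ 2) + x $ 2 * w $ 1)\<^sup>2 = (x $ 1)\<^sup>2 + (x $ 2)\<^sup>2"
        using n unfolding power2_eq_square by algebra
      then show ?thesis
        by (simp add: norm_vec_def L2_set_def sum_2 g_def inner_vec2 perp_components)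
    qed
    then show "\<forall>x. norm (g x) = norm x" by simp
  qed
  moreover have "g (f x) = x" for x
  proof -
    have "(x $ 1 * w $ 1 - x $ 2 * w $ 2) * w $ 1 + (x $ 1 * w $ 2 + x $ 2 * w $ 1) * w $ 2 = x $ 1"
      "- ((x $ 1 * w $ 1 - x $ 2 * w $ 2) * w $ 2) + (x $ 1 * w $ 2 + x $ 2 * w $ 1) * w $ 1 = x $ 2"
      using n by algebra+
    then show ?thesis
      by (simp add: f_def g_def line_coords_def vec_eq_iff forall_2 inner_vec2 perp_components)
  qed
  then have pre: "f -` S = g ` S" for S
    using fg by (auto simp: image_iff) metis
  moreover have "box l u \<in> lmeasurable" by simp
  ultimately have "g ` box l u \<in> lmeasurable" "measure lebesgue (g ` box l u) = measure lebesgue (box l u)"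
    using measurable_orthogonal_image[of g "box l u"] measure_orthogonal_image[of g "box l u"] by blast+
  then have "emeasure lebesgue (g ` box l u) = emeasure lebesgue (box l u)"
    by (simp add: emeasure_eq_measure2)
  moreover have meas: "f \<in> borel_measurable borel"
    unfolding f_def line_coords_def by (auto intro!: borel_measurable_continuous_onI continuous_intros)
  then have "f -` box l u \<in> sets borel"
    using measurable_sets[OF meas, of "box l u"] by simp
  ultimately have "emeasure lborel (f -` box l u) = emeasure lborel (box l u)"
    by (simp add: pre)
  then show "emeasure (distr lborel borel (\<lambda>x::real^2. line_coords w (x $ 1, x $ 2))) (box l u) = ennreal (\<Prod>b\<in>Basis. (u - l) \<bullet> b)"
    using meas le unfolding f_def[symmetric]
    by (subst emeasure_distr) auto
qed simp

lemma distr_lborel_line_coords: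
  assumes "w \<in> sphere 0 1"
  shows "distr (lborel \<Otimes>\<^sub>M lborel) borel (line_coords w) = lborel"
proof -
  have meas: "(\<lambda>(a, b). vector [a, b] :: real^2) \<in> borel_measurable borel"
    using measurable_line_coords[of "axis 1 1"]
    by (simp add: line_coords_axis[symmetric] case_prod_beta cong: measurable_cong)
  have meas2: "(\<lambda>x::real^2. line_coords w (x $ 1, x $ 2)) \<in> borel_measurable borel"
    unfolding line_coords_def by (auto intro!: borel_measurable_continuous_onI continuous_intros)
  have "lborel = distr (distr lborel borel (\<lambda>(a, b). vector [a, b])) borel (\<lambda>x::real^2. line_coords w (x $ 1, x $ 2))"
    using distr_lborel_rotation[OF assms] by (simp add: distr_lborel_vector)
  also have "\<dots> = distr lborel borel ((\<lambda>x::real^2. line_coords w (x $ 1, x $ 2)) \<circ> (\<lambda>(a, b). vector [a, b]))"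
    using meas meas2 by (intro distr_distr) auto
  also have "(\<lambda>x::real^2. line_coords w (x $ 1, x $ 2)) \<circ> (\<lambda>(a, b). vector [a, b]) = line_coords w"
    by auto
  finally show ?thesis by (simp add: lborel_prod)
qed

lemma line_coords_measurable_pair [measurable]: "line_coords w \<in> borel_measurable (lborel \<Otimes>\<^sub>M lborel)"
  by (simp add: lborel_prod)

text \<open>Fubini after the measure-preserving change of variables \<open>line_coords w\<close>;
  the inner integral runs along the single line \<open>line w p\<close>.\<close>

lemma
  fixes h :: "real^2 \<Rightarrow> 'b :: {banach, second_countable_topology}"
  assumes "w \<in> sphere 0 1" and h: "integrable lborel h"
  shows integrable_line_coords: "integrable (lborel \<Otimes>\<^sub>M lborel) (\<lambda>z. h (line_coords w z))"
    and integral_line_coords: "(LINT x|lborel. h x) = (LINT p|lborel. LINT t|lborel. h (line_coords w (p, t)))"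
proof -
  have meas: "h \<in> borel_measurable borel" using h by simp
  show I: "integrable (lborel \<Otimes>\<^sub>M lborel) (\<lambda>z. h (line_coords w z))"
    using h unfolding distr_lborel_line_coords[OF assms(1), symmetric]
    by (rule integrable_distr[rotated]) simp
  have "(LINT x|lborel. h x) = (LINT z|(lborel \<Otimes>\<^sub>M lborel). h (line_coords w z))"
    using meas by (subst distr_lborel_line_coords[OF assms(1), symmetric]) (simp add: integral_distr)
  then show "(LINT x|lborel. h x) = (LINT p|lborel. LINT t|lborel. h (line_coords w (p, t)))"
    using lborel_pair.integral_fst'[OF I] by simp
qed

lemma AE_line_coords:
  assumes "w \<in> sphere 0 1" and "AE x in lborel. P x"
  shows "AE p in lborel. AE t in lborel. P (line_coords w (p, t))"
proof -
  have "AE z in lborel \<Otimes>\<^sub>M lborel. P (line_coords w z)"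
    using assms(2) unfolding distr_lborel_line_coords[OF assms(1), symmetric]
    by (rule AE_distrD[rotated]) simp
  then show ?thesis by (rule lborel_pair.AE_pair)
qed

section \<open>Supports and squares\<close>

text \<open>By Lindelof a countable subfamily of the open sets removed in \<open>supp\<close> has
  the same union, so their exceptional null sets can be collected into one.\<close>

lemma AE_in_supp: "AE x in lborel. x \<in> supp u \<or> u x = 0"
proof -
  define \<U> where "\<U> = {U. open U \<and> (AE x in lborel. x \<in> U \<longrightarrow> u x = 0)}"
  obtain \<U>' where \<U>': "\<U>' \<subseteq> \<U>" "countable \<U>'" "\<Union>\<U>' = \<Union>\<U>"
    using Lindelof[of \<U>] by (auto simp: \<U>_def)
  have "AE x in lborel. \<forall>U\<in>\<U>'. x \<in> U \<longrightarrow> u x = 0"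
    using \<U>' by (subst AE_ball_countable) (auto simp: \<U>_def)
  then show ?thesis
    by eventually_elim (use \<U>'(3) in \<open>auto simp: supp_def \<U>_def\<close>)
qed

lemma compact_in_open_square:
  assumes "compact K" "K \<subseteq> open_square 1"
  obtains \<kappa> where "0 \<le> \<kappa>" "\<kappa> < 1" "\<And>x i. x \<in> K \<Longrightarrow> \<bar>x $ i\<bar> \<le> \<kappa>"
proof (cases "K = {}")
  case True
  then show ?thesis using that[of 0] by simp
next
  case False
  have "continuous_on K (\<lambda>x. max \<bar>x $ 1\<bar> \<bar>x $ 2\<bar>)"
    by (intro continuous_intros)
  then obtain y where y: "y \<in> K" "\<And>x. x \<in> K \<Longrightarrow> max \<bar>x $ 1\<bar> \<bar>x $ 2\<bar> \<le> max \<bar>y $ 1\<bar> \<bar>y $ 2\<bar>"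
    using continuous_attains_sup[OF assms(1) False] by blast
  have "\<bar>y $ i\<bar> < 1" for i
    using y(1) assms(2) by (auto simp: open_square_def abs_less_iff minus_less_iff)
  then have "max \<bar>y $ 1\<bar> \<bar>y $ 2\<bar> < 1" by simp
  moreover have "\<bar>x $ i\<bar> \<le> max \<bar>y $ 1\<bar> \<bar>y $ 2\<bar>" if "x \<in> K" for x i
    using y(2)[OF that] exhaust_2[of i] by auto
  ultimately show ?thesis
    using that[of "max \<bar>y $ 1\<bar> \<bar>y $ 2\<bar>"] by auto
qed

text \<open>The bound on the offset is the support function of the square in direction
  \<open>w\<close>; smaller offsets are attained by shrinking a corner.\<close>

lemma line_meets_open_square:
  assumes "w \<in> sphere 0 1" "\<bar>p\<bar> < \<delta> * (\<bar>w $ 1\<bar> + \<bar>w $ 2\<bar>)"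
  shows "line w p \<inter> open_square \<delta> \<noteq> {}"
proof -
  define s where "s = \<bar>w $ 1\<bar> + \<bar>w $ 2\<bar>"
  have "s \<noteq> 0"
    using assms(1) unfolding sphere_vec2 by (auto simp: s_def add_nonneg_eq_0_iff)
  then have s: "s > 0" by (simp add: s_def)
  have d: "\<bar>p / s\<bar> < \<delta>"
    using assms(2) s by (simp add: s_def[symmetric] divide_less_eq)
  \<comment> \<open>A multiple of the sign vector of \<open>w\<close>, scaled so that its inner
    product with \<open>w\<close> is \<open>p\<close>.\<close>
  define x :: "real^2" where "x = (\<chi> i. p / s * sgn (w $ i))"
  have "x \<bullet> w = p / s * (w $ 1 * sgn (w $ 1) + w $ 2 * sgn (w $ 2))"
    by (simp add: inner_vec2 x_def distrib_left mult_ac)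
  then have "x \<bullet> w = p / s * s"
    by (simp only: s_def abs_sgn)
  then have "x \<in> line w p" using s by (simp add: line_def)
  moreover have "\<bar>x $ i\<bar> < \<delta>" for i
    using d le_less_trans[OF abs_ge_zero d] by (auto simp: x_def abs_mult sgn_real_def)
  then have "x \<in> open_square \<delta>"
    by (auto simp: open_square_def abs_less_iff minus_less_iff)
  ultimately show ?thesis by blast
qed

section \<open>Polynomials separating the two squares\<close>

text \<open>After division by \<open>z ^ l\<close>, which has norm one on the circle, the
  coefficient is the value at the centre, and the maximum modulus principle applies.\<close>

lemma norm_lowest_coeff_le:
  fixes p :: "complex poly"
  assumes low: "\<And>i. i < l \<Longrightarrow> coeff p i = 0"
    and bnd: "\<And>z. norm z = 1 \<Longrightarrow> norm (poly p z) \<le> C"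
  shows "norm (coeff p l) \<le> C"
proof -
  have "monom 1 l dvd p"
    using low by (simp add: monom_1_dvd_iff')
  then obtain q where q: "p = monom 1 l * q" ..
  have "norm (poly q 0) \<le> C"
  proof (rule maximum_modulus_frontier[where S = "cball 0 1" and f = "poly q"])
    show "norm (poly q z) \<le> C" if "z \<in> frontier (cball 0 1)" for z
      using bnd[of z] that by (simp add: q poly_monom norm_mult norm_power)
  qed (auto intro!: holomorphic_intros continuous_intros poly_holomorphic_on)
  moreover have "coeff p l = poly q 0"
    by (simp add: q coeff_monom_mult poly_0_coeff_0)
  ultimately show ?thesis by simp
qed

text \<open>If \<open>M k\<close> is the integral of \<open>u * Y ^ k\<close>, one step inserts the
  factor \<open>a + h * Y ^ 2\<close> under the integral.\<close>

definition moment_step :: "complex poly \<Rightarrow> complex poly \<Rightarrow> (nat \<Rightarrow> complex poly) \<Rightarrow> nat \<Rightarrow> complex poly"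
  where "moment_step a h M k = a * M k + h * M (k + 2)"

text \<open>Since \<open>h\<close> vanishes at 0, the term with \<open>M (k + 2)\<close> only
  contributes above order \<open>l\<close>. The vanishing below \<open>l\<close> is assumed for the
  whole sequence because a step mixes \<open>k\<close> and \<open>k + 2\<close>.\<close>

lemma moment_step_lowest_coeff:
  assumes "coeff h 0 = 0" and "\<And>k i. i < l \<Longrightarrow> coeff (M k) i = 0"
  shows "i < l \<Longrightarrow> coeff (moment_step a h M k) i = 0"
    and "coeff (moment_step a h M k) l = coeff a 0 * coeff (M k) l"
proof -
  show "coeff (moment_step a h M k) i = 0" if "i < l"
    using assms(2) that by (simp add: moment_step_def coeff_mult)
  have "(\<Sum>i\<le>l. coeff a i * coeff (M k) (l - i)) = (\<Sum>i\<in>{0}. coeff a i * coeff (M k) (l - i))"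
    using assms(2) by (intro sum.mono_neutral_right) auto
  moreover have "(\<Sum>i\<le>l. coeff h i * coeff (M (k + 2)) (l - i)) = 0"
  proof (rule sum.neutral, intro ballI)
    fix i assume "i \<in> {..l}"
    show "coeff h i * coeff (M (k + 2)) (l - i) = 0"
      using assms \<open>i \<in> {..l}\<close> by (cases "i = 0") auto
  qed
  ultimately show "coeff (moment_step a h M k) l = coeff a 0 * coeff (M k) l"
    by (simp add: moment_step_def coeff_mult)
qed

text \<open>Strong induction on the order \<open>l\<close>, for all \<open>k\<close> at once: when
  all lower coefficients vanish, each step multiplies the coefficient of order \<open>l\<close> by
  \<open>coeff a 0\<close>. It also stays bounded, so geometric growth forces it to be zero.\<close>

lemma moment_step_bounded_imp_zero:
  assumes h: "coeff h 0 = 0" and a: "norm (coeff a 0) > 1"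
    and bnd: "\<And>k. \<exists>C. \<forall>N z. norm z = 1 \<longrightarrow> norm (poly ((moment_step a h ^^ N) M k) z) \<le> C"
  shows "M k = 0"
proof -
  have "coeff (M k) l = 0" for k l
  proof (induction l arbitrary: k rule: less_induct)
    case (less l)
    have it: "(\<forall>k. \<forall>i<l. coeff ((moment_step a h ^^ N) M k) i = 0) \<and>
        (\<forall>k. coeff ((moment_step a h ^^ N) M k) l = coeff a 0 ^ N * coeff (M k) l)" for N
    proof (induction N)
      case 0
      then show ?case using less by simp
    next
      case (Suc N)
      then show ?case
        using moment_step_lowest_coeff[OF h, where l = l and M = "(moment_step a h ^^ N) M" and a = a] by simp
    qed
    obtain C where C: "\<And>N z. norm z = 1 \<Longrightarrow> norm (poly ((moment_step a h ^^ N) M k) z) \<le> C"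
      using bnd by metis
    have le: "norm (coeff a 0) ^ N * norm (coeff (M k) l) \<le> C" for N
      using norm_lowest_coeff_le[of l "(moment_step a h ^^ N) M k" C] it[of N] C
      by (simp add: norm_mult norm_power)
    show ?case
    proof (rule ccontr)
      assume "coeff (M k) l \<noteq> 0"
      then have pos: "norm (coeff (M k) l) > 0" by simp
      obtain N where "C / norm (coeff (M k) l) < norm (coeff a 0) ^ N"
        using real_arch_pow[OF a] by blast
      then show False using le[of N] pos by (simp add: field_simps)
    qed
  qed
  then show ?thesis by (simp add: poly_eq_iff)
qed

section \<open>Powers of the cosine as real parts of polynomials\<close>

text \<open>Expand \<open>((z + cnj z) / 2) ^ n\<close>. On the circle \<open>cnj z\<close> is the
  inverse of \<open>z\<close>, and conjugation preserves real parts, so negative powers can be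
  replaced by positive ones. The constant coefficient is the circle mean of
  \<open>Re z ^ n\<close>.\<close>

lemma exists_poly_Re_eq_power:
  "\<exists>A :: complex poly. (\<forall>z. norm z = 1 \<longrightarrow> Re (poly A z) = Re z ^ n) \<and>
     coeff A 0 = (if even n then of_real (real (n choose (n div 2)) / 2 ^ n) else 0)"
proof -
  \<comment> \<open>By truncated subtraction this is the absolute value of \<open>2 * j - n\<close>,
    the net exponent of \<open>z\<close> in the \<open>j\<close>-th term.\<close>
  define e where "e j = (2 * j - n) + (n - 2 * j)" for j
  define A :: "complex poly" where
    "A = (\<Sum>j\<le>n. monom (of_real (real (n choose j) / 2 ^ n)) (e j))"
  have "Re (poly A z) = Re z ^ n" if z: "norm z = 1" for z
  proof -
    have zz: "z * cnj z = 1" using z by (simp add: complex_norm_square[symmetric])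
    have Re_e: "Re (z ^ j * cnj z ^ (n - j)) = Re (z ^ e j)" if "j \<le> n" for j
    proof (cases "n \<le> 2 * j")
      case True
      have "z ^ j * cnj z ^ (n - j) = z ^ (2 * j - n) * (z * cnj z) ^ (n - j)"
        using True that by (simp add: power_mult_distrib flip: power_add mult.assoc)
      then show ?thesis using True by (simp add: zz e_def)
    next
      case False
      have "z ^ j * cnj z ^ (n - j) = cnj z ^ (n - 2 * j) * (z * cnj z) ^ j"
        using False that by (simp add: power_mult_distrib mult_ac flip: power_add)
      then have "z ^ j * cnj z ^ (n - j) = cnj (z ^ (n - 2 * j))" by (simp add: zz)
      then have "Re (z ^ j * cnj z ^ (n - j)) = Re (z ^ (n - 2 * j))" by (metis cnj.simps(1))
      then show ?thesis using False by (simp add: e_def)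
    qed
    have "of_real (Re z) = (z + cnj z) / 2"
      by (simp add: complex_add_cnj)
    then have "of_real (Re z ^ n) = (z + cnj z) ^ n / 2 ^ n"
      unfolding of_real_power by (simp only: power_divide)
    also have "\<dots> = (\<Sum>j\<le>n. of_real (real (n choose j) / 2 ^ n) * (z ^ j * cnj z ^ (n - j)))"
      by (simp add: binomial_ring sum_divide_distrib mult_ac)
    finally have "Re z ^ n = Re (\<Sum>j\<le>n. of_real (real (n choose j) / 2 ^ n) * (z ^ j * cnj z ^ (n - j)))"
      by (metis Re_complex_of_real)
    also have "\<dots> = (\<Sum>j\<le>n. (real (n choose j) / 2 ^ n) * Re (z ^ j * cnj z ^ (n - j)))"
      unfolding Re_sum
      by (intro sum.cong refl)
        (simp only: times_complex.sel Re_complex_of_real Im_complex_of_real mult_zero_left diff_0_right)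
    also have "\<dots> = (\<Sum>j\<le>n. (real (n choose j) / 2 ^ n) * Re (z ^ e j))"
      by (intro sum.cong refl) (simp only: Re_e atMost_iff)
    finally show ?thesis
      by (simp add: A_def poly_sum poly_monom)
  qed
  moreover have "coeff A 0 = (if even n then of_real (real (n choose (n div 2)) / 2 ^ n) else 0)"
  proof -
    have "coeff A 0 = (\<Sum>j\<le>n. if 2 * j = n then of_real (real (n choose j) / 2 ^ n) else 0)"
      unfolding A_def coeff_sum by (intro sum.cong) (auto simp: e_def)
    also have "\<dots> = (\<Sum>j\<le>n. if j = n div 2 then (if even n then of_real (real (n choose (n div 2)) / 2 ^ n) else 0) else 0)"
      by (intro sum.cong) auto
    also have "\<dots> = (if even n then of_real (real (n choose (n div 2)) / 2 ^ n) else 0)"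
      by simp
    finally show ?thesis .
  qed
  ultimately show ?thesis by blast
qed

text \<open>The ratio of consecutive even moments of the cosine. It tends to 1 as \<open>m\<close>
  grows, which expresses that the weight concentrates where the cosine is 1 or -1.\<close>

lemma central_binomial_ratio:
  "real ((2 * m + 2) choose (m + 1)) / 2 ^ (2 * m + 2) =
   real ((2 * m) choose m) / 2 ^ (2 * m) * (2 * m + 1) / (2 * m + 2)"
proof -
  have 1: "Suc m * (Suc (2 * m + 1) choose Suc m) = Suc (2 * m + 1) * ((2 * m + 1) choose m)"
    by (rule Suc_times_binomial_eq[symmetric, THEN trans[rotated]]) simp
  have 2: "Suc m * (Suc (2 * m) choose Suc m) = Suc (2 * m) * ((2 * m) choose m)"
    by (metis Suc_times_binomial_eq mult.commute)
  have 3: "(2 * m + 1) choose m = Suc (2 * m) choose Suc m"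
    using binomial_symmetric[of m "2 * m + 1"] by simp
  have "real (m + 1) * real ((2 * m + 2) choose (m + 1)) = real (2 * m + 2) * real ((2 * m + 1) choose m)"
    using 1 by (metis Suc_eq_plus1 add_Suc_right of_nat_mult one_add_one)
  moreover have "real (m + 1) * real ((2 * m + 1) choose m) = real (2 * m + 1) * real ((2 * m) choose m)"
    using 2 3 by (metis Suc_eq_plus1 of_nat_mult)
  ultimately have eq: "real (m+1) * (real (m + 1) * real ((2 * m + 2) choose (m + 1))) = real (2 * m + 2) * (real (2 * m + 1) * real ((2 * m) choose m))"
    by (simp add: algebra_simps)
  have ratio: "X / (4 * P) = Y / P * (2 * t + 1) / (2 * t + 2)"
    if "(t + 1) * ((t + 1) * X) = (2 * t + 2) * ((2 * t + 1) * Y)" "t \<ge> 0" "P > 0" for t X Y P :: real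
  proof -
    have "(t + 1) * ((t + 1) * X - 2 * ((2 * t + 1) * Y)) = 0"
      using that(1) by (simp add: algebra_simps)
    then have "(t + 1) * X = 2 * ((2 * t + 1) * Y)"
      using that(2) by simp
    then have "X = 2 * ((2 * t + 1) * Y) / (t + 1)"
      using that(2) by (simp add: eq_divide_eq mult.commute)
    moreover have "2 * t + 2 = 2 * (t + 1)" by simp
    ultimately show ?thesis by simp
  qed
  have "real ((2 * m + 2) choose (m + 1)) / (4 * 2 ^ (2 * m)) =
      real ((2 * m) choose m) / 2 ^ (2 * m) * (2 * real m + 1) / (2 * real m + 2)"
    using eq by (intro ratio) (simp_all add: mult_ac add_ac del: binomial_Suc_Suc)
  then show ?thesis by (simp add: power_add mult.commute add.commute del: binomial_Suc_Suc)
qed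

text \<open>With \<open>c = cos (4 * \<theta>)\<close> and \<open>h = - e * H / \<zeta>\<close>, \<open>a = 1 + e * B\<close> for small \<open>e\<close>, it suffices that
  \<open>Re B < \<tau> * Re H\<close> on the given intervals. The weight \<open>Re H = - c ^ (2 * m + 1)\<close> is negative near the
  upper contact points of the squares and a circle between them (\<open>c = 1\<close>) and positive near the lower
  ones (\<open>c = - 1\<close>). Since \<open>H\<close> has mean zero and the weight concentrates at these points as \<open>m\<close> grows,
  the minimum of \<open>\<tau> * Re H\<close> has positive mean, so \<open>B 0 > 0\<close> is possible.\<close>

lemma exists_separating_poly_pair:
  assumes "0 \<le> \<kappa>" "\<kappa> < 1"
  shows "\<exists>a h :: complex poly. coeff h 0 = 0 \<and> norm (coeff a 0) > 1 \<and>
    (\<forall>\<theta> \<tau>. (1 + \<bar>sin (2 * \<theta>)\<bar>) / 2 \<le> \<tau> \<longrightarrow> \<tau> \<le> \<kappa>\<^sup>2 * (1 + \<bar>sin (2 * \<theta>)\<bar>) \<longrightarrow>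
      norm (poly a (cis (2 * \<theta>)) + poly h (cis (2 * \<theta>)) * (cis (2 * \<theta>) * of_real \<tau>)) \<le> 1)"
proof -
  \<comment> \<open>\<open>\<eta>\<close> measures the gap between the supporting square and the
    unit square, and \<open>g\<close> is the slack gained from it near \<open>c = 1\<close>.
    \<open>L\<close> weights the penalty \<open>1 - c^2\<close>: it is at least 1/4, as the case
    \<open>c \<le> 0\<close> uses, and it comes from the AM-GM bound on \<open>s\<close> in the case
    \<open>c > 0\<close>.\<close>
  define \<eta> where "\<eta> = 1 - \<kappa>\<^sup>2"
  define g where "g = \<eta> / 4"
  define L where "L = 1 / (4 * \<eta>)"
  have \<eta>: "0 < \<eta>" "\<eta> \<le> 1"
    using assms by (auto simp: \<eta>_def power_less_one_iff abs_square_less_1)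
  have L: "1 / 4 \<le> L" and g: "0 < g"
    using \<eta> by (auto simp: L_def g_def divide_simps)
  \<comment> \<open>This size of \<open>m\<close> yields
    \<open>L * (2 * m + 2) < (g + L) * (2 * m + 1)\<close>, which is what makes \<open>e0\<close>
    positive.\<close>
  obtain m where m: "L / g < real m"
    using reals_Archimedean2 by blast
  define \<mu> where "\<mu> m = real ((2 * m) choose m) / 2 ^ (2 * m)" for m :: nat
  have \<mu>_pos: "\<mu> m > 0" by (simp add: \<mu>_def)
  have \<mu>_Suc: "\<mu> (Suc m) = \<mu> m * (2 * m + 1) / (2 * m + 2)"
    using central_binomial_ratio[of m] by (simp add: \<mu>_def)
  \<comment> \<open>Half the circle mean of
    \<open>c ^ (2 * m) * ((g - 1) * c + g * c^2 - L * (1 - c^2))\<close>. Subtracting it from this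
    function leaves the mean \<open>e0\<close> for \<open>B\<close> and the margin \<open>e0\<close>
    in \<open>Re_X\<close>.\<close>
  define e0 where "e0 = ((g + L) * \<mu> (Suc m) - L * \<mu> m) / 2"
  have e0: "e0 > 0"
  proof -
    have "L < g * (2 * m + 1)"
      using m g L by (simp add: field_simps)
    then have "L * (2 * m + 2) < (g + L) * (2 * m + 1)"
      by (simp add: algebra_simps)
    then have "\<mu> m * (L * (2 * m + 2)) < \<mu> m * ((g + L) * (2 * m + 1))"
      using \<mu>_pos by simp
    then show ?thesis
      by (simp add: e0_def \<mu>_Suc field_simps)
  qed
  obtain A1 :: "complex poly" where A1: "\<And>z. norm z = 1 \<Longrightarrow> Re (poly A1 z) = Re z ^ (2 * m + 1)"
      and A1_0: "coeff A1 0 = 0"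
    using exists_poly_Re_eq_power[of "2 * m + 1"] by auto
  obtain A2 :: "complex poly" where A2: "\<And>z. norm z = 1 \<Longrightarrow> Re (poly A2 z) = Re z ^ (2 * Suc m)"
      and A2_0: "coeff A2 0 = of_real (\<mu> (Suc m))"
    using exists_poly_Re_eq_power[of "2 * Suc m"] by (auto simp: \<mu>_def simp del: binomial_Suc_Suc)
  obtain A0 :: "complex poly" where A0: "\<And>z. norm z = 1 \<Longrightarrow> Re (poly A0 z) = Re z ^ (2 * m)"
      and A0_0: "coeff A0 0 = of_real (\<mu> m)"
    using exists_poly_Re_eq_power[of "2 * m"] by (auto simp: \<mu>_def)
  \<comment> \<open>With this factor split off, \<open>A1\<close> evaluated at \<open>z ^ 2\<close>
    can be divided by \<open>z\<close> and still keeps a factor \<open>z\<close>, so that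
    \<open>h1\<close> vanishes at 0.\<close>
  obtain A1' where A1': "A1 = [:0, 1:] * A1'"
    using A1_0 by (metis dvdE dvd_iff_poly_eq_0 minus_zero poly_0_coeff_0)
  \<comment> \<open>At \<open>z = cis (2 * \<theta>)\<close>, composition with \<open>sq\<close>
    turns \<open>Re z\<close> into \<open>c = cos (4 * \<theta>)\<close>.\<close>
  define sq :: "complex poly" where "sq = [:0, 0, 1:]"
  have sq: "poly sq z = z\<^sup>2" for z by (simp add: sq_def power2_eq_square)
  define h1 where "h1 = - ([:0, 1:] * pcompose A1' sq)"
  define B where "B = pcompose (smult (of_real (g - 1)) A1 + smult (of_real (g + L)) A2
      - smult (of_real L) A0 - [:of_real e0:]) sq"
  have h1_0: "coeff h1 0 = 0" by (simp add: h1_def)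
  have B_0: "coeff B 0 = of_real e0"
    by (simp add: B_def sq_def e0_def A1_0 A2_0 A0_0 flip: poly_0_coeff_0)
       (simp add: poly_pcompose poly_0_coeff_0 A1_0 A2_0 A0_0 field_simps)
  have h1: "poly h1 z * z = - poly A1 (z\<^sup>2)" for z
    by (simp add: h1_def A1' poly_pcompose sq power2_eq_square)
  \<comment> \<open>The first-order term in \<open>e\<close>: with \<open>a\<close> and
    \<open>h\<close> as chosen below, the expression to be bounded is \<open>1 + e * X\<close>. A
    negative upper bound on \<open>Re X\<close> brings its norm to at most 1 for small
    \<open>e\<close>.\<close>
  define X where "X \<theta> \<tau> = poly B (cis (2 * \<theta>)) - poly h1 (cis (2 * \<theta>)) * (cis (2 * \<theta>) * of_real \<tau>)" for \<theta> \<tau>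
  have Re_X: "Re (X \<theta> \<tau>) \<le> - e0"
    if lo: "(1 + \<bar>sin (2 * \<theta>)\<bar>) / 2 \<le> \<tau>" and hi: "\<tau> \<le> \<kappa>\<^sup>2 * (1 + \<bar>sin (2 * \<theta>)\<bar>)" for \<theta> \<tau>
  proof -
    define s where "s = \<bar>sin (2 * \<theta>)\<bar>"
    define c where "c = cos (4 * \<theta>)"
    define w where "w = c ^ (2 * m)"
    have s: "0 \<le> s" "s \<le> 1" by (auto simp: s_def)
    have c: "- 1 \<le> c" "c \<le> 1" by (auto simp: c_def)
    have w: "w \<ge> 0" by (simp add: w_def)
    have s2: "s\<^sup>2 = (1 - c) / 2"
      using cos_double_sin[of "2 * \<theta>"] by (simp add: s_def c_def)
    have W: "(cis (2 * \<theta>))\<^sup>2 = cis (4 * \<theta>)" by (simp add: DeMoivre power2_eq_square cis_mult)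
    have "Re (X \<theta> \<tau>) = Re (poly B (cis (2 * \<theta>))) - Re (poly h1 (cis (2 * \<theta>)) * cis (2 * \<theta>)) * \<tau>"
      by (simp add: X_def mult.assoc[symmetric])
    also have "\<dots> = (g - 1) * c ^ (2 * m + 1) + (g + L) * c ^ (2 * Suc m) - L * c ^ (2 * m) - e0 + c ^ (2 * m + 1) * \<tau>"
      using A1[of "cis (4 * \<theta>)"] A2[of "cis (4 * \<theta>)"] A0[of "cis (4 * \<theta>)"]
      by (simp add: h1 W B_def poly_pcompose sq c_def)
    also have "\<dots> = w * ((g - 1) * c + g * c\<^sup>2 - L * (1 - c\<^sup>2) + c * \<tau>) - e0"
      by (simp add: w_def algebra_simps power2_eq_square)
    also have "(g - 1) * c + g * c\<^sup>2 - L * (1 - c\<^sup>2) + c * \<tau> \<le> 0"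
    \<comment> \<open>The sign of \<open>c\<close> decides which end of the interval for
      \<open>\<tau>\<close> is critical: the lower one for \<open>c \<le> 0\<close>, estimated by
      \<open>s \<ge> s^2\<close>, and the upper one for \<open>c > 0\<close>, estimated by
      AM-GM.\<close>
    proof (cases "c \<le> 0")
      case True
      have "(3 - c) / 4 \<le> (1 + s) / 2"
        using s s2 mult_left_le[of s s] by (simp add: power2_eq_square)
      then have "(3 - c) / 4 \<le> \<tau>" using lo by (simp add: s_def)
      then have "c * \<tau> \<le> c * ((3 - c) / 4)" using True by (rule mult_left_mono_neg)
      then have 1: "c * \<tau> \<le> (3 * c - c\<^sup>2) / 4" by (simp add: algebra_simps power2_eq_square)
      have 2: "1 / 4 * (1 - c\<^sup>2) \<le> L * (1 - c\<^sup>2)"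
        using L c by (intro mult_right_mono) (auto simp: abs_square_le_1)
      have "g * (c * (1 + c)) \<le> 0"
        using g c True by (auto simp: mult_le_0_iff)
      then have 3: "g * c + g * c\<^sup>2 \<le> 0" by (simp add: algebra_simps power2_eq_square)
      have "(g - 1) * c + g * c\<^sup>2 - L * (1 - c\<^sup>2) + c * \<tau> =
          (g * c + g * c\<^sup>2) - c - L * (1 - c\<^sup>2) + c * \<tau>" by (simp add: left_diff_distrib)
      also have "\<dots> \<le> 0 - c - 1 / 4 * (1 - c\<^sup>2) + (3 * c - c\<^sup>2) / 4"
        by (intro add_mono diff_mono 1 2 3 order.refl)
      also have "\<dots> \<le> 0" using c by (simp add: field_simps)
      finally show ?thesis .
    next
      case False
      have amgm: "s \<le> \<eta> / 2 + (1 - c) * L"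
      proof -
        have "0 \<le> (\<eta> - s)\<^sup>2" by simp
        then have "s * \<eta> \<le> (\<eta> / 2 + s\<^sup>2 / (2 * \<eta>)) * \<eta>" using \<eta>
          by (simp add: algebra_simps power2_eq_square)
        then have "s \<le> \<eta> / 2 + s\<^sup>2 / (2 * \<eta>)" using \<eta> by simp
        then show ?thesis by (simp add: s2 L_def)
      qed
      have "\<tau> \<le> (1 - \<eta>) * (1 + s)" using hi by (simp add: s_def \<eta>_def)
      also have "\<dots> \<le> (1 - \<eta>) * (1 + (\<eta> / 2 + (1 - c) * L))"
        using amgm \<eta> by (intro mult_left_mono) auto
      also have "\<dots> \<le> 1 - 2 * g + (1 - c) * L"
      proof -
        have "(1 - \<eta>) * (1 + \<eta> / 2) \<le> 1 - 2 * g"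
          by (simp add: g_def algebra_simps)
        moreover have "(1 - \<eta>) * ((1 - c) * L) \<le> 1 * ((1 - c) * L)"
          using \<eta> c L by (intro mult_right_mono) auto
        ultimately show ?thesis by (simp add: distrib_left)
      qed
      finally have "c * \<tau> \<le> c * (1 - 2 * g + (1 - c) * L)"
        using False by (intro mult_left_mono) auto
      moreover have "c * (1 - c) * L \<le> (1 - c\<^sup>2) * L"
        using L c False by (intro mult_right_mono) (auto simp: power2_eq_square algebra_simps)
      moreover have "g * (c * (1 - c)) \<ge> 0"
        using g c False by auto
      ultimately show ?thesis
        by (simp add: algebra_simps power2_eq_square)
    qed
    then have "w * ((g - 1) * c + g * c\<^sup>2 - L * (1 - c\<^sup>2) + c * \<tau>) - e0 \<le> - e0"
      using w by (simp add: mult_nonneg_nonpos)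
    finally show ?thesis .
  qed
  have "\<exists>K>0. \<forall>z. norm z = 1 \<longrightarrow> norm (poly p z) \<le> K" for p :: "complex poly"
  proof -
    have "bounded (poly p ` sphere 0 1)"
      by (intro compact_imp_bounded compact_continuous_image continuous_intros) auto
    then show ?thesis by (auto simp: bounded_pos)
  qed
  then obtain K1 K2 where K: "K1 > 0" "K2 > 0" "\<And>z. norm z = 1 \<Longrightarrow> norm (poly B z) \<le> K1"
      "\<And>z. norm z = 1 \<Longrightarrow> norm (poly h1 z) \<le> K2"
    by metis
  define C where "C = K1 + K2 * 2"
  have C: "C > 0" using K by (simp add: C_def)
  \<comment> \<open>At this value \<open>e^2 * C^2 = 2 * e * e0\<close>, so the quadratic term of
    the squared norm is exactly offset by the margin in \<open>Re_X\<close>.\<close>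
  define e where "e = 2 * e0 / C\<^sup>2"
  have e: "e > 0" using e0 C by (simp add: e_def)
  define a where "a = 1 + smult (of_real e) B"
  define h where "h = smult (- of_real e) h1"
  have "norm (poly a (cis (2 * \<theta>)) + poly h (cis (2 * \<theta>)) * (cis (2 * \<theta>) * of_real \<tau>)) \<le> 1"
    if lo: "(1 + \<bar>sin (2 * \<theta>)\<bar>) / 2 \<le> \<tau>" and hi: "\<tau> \<le> \<kappa>\<^sup>2 * (1 + \<bar>sin (2 * \<theta>)\<bar>)" for \<theta> \<tau>
  proof -
    have \<tau>0: "0 \<le> \<tau>" using lo by (smt (verit) divide_nonneg_nonneg)
    have "\<tau> \<le> 1 * (1 + \<bar>sin (2 * \<theta>)\<bar>)"
      using \<eta> by (intro order.trans[OF hi] mult_right_mono) (auto simp: \<eta>_def)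
    also have "\<dots> \<le> 2" using abs_sin_le_one[of "2 * \<theta>"] by simp
    finally have \<tau>2: "\<tau> \<le> 2" .
    have "norm (X \<theta> \<tau>) \<le> norm (poly B (cis (2 * \<theta>))) + norm (poly h1 (cis (2 * \<theta>))) * \<tau>"
      unfolding X_def using \<tau>0 by (intro order.trans[OF norm_triangle_ineq4]) (simp add: norm_mult)
    also have "\<dots> \<le> K1 + K2 * 2"
      using K \<tau>0 \<tau>2 by (intro add_mono mult_mono) auto
    finally have nX: "norm (X \<theta> \<tau>) \<le> C" by (simp add: C_def)
    have "(norm (1 + of_real e * X \<theta> \<tau>))\<^sup>2 = 1 + 2 * e * Re (X \<theta> \<tau>) + e\<^sup>2 * (norm (X \<theta> \<tau>))\<^sup>2"
      unfolding cmod_power2 by (simp add: power2_eq_square algebra_simps)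
    also have "\<dots> \<le> 1 + 2 * e * (- e0) + e\<^sup>2 * C\<^sup>2"
      using Re_X[OF lo hi] e nX by (intro add_mono mult_left_mono power_mono) auto
    also have "e\<^sup>2 * C\<^sup>2 = 2 * e * e0"
      using C by (simp add: e_def power2_eq_square)
    finally have "(norm (1 + of_real e * X \<theta> \<tau>))\<^sup>2 \<le> 1\<^sup>2" by simp
    then have "norm (1 + of_real e * X \<theta> \<tau>) \<le> 1"
      by (rule power2_le_imp_le) simp
    moreover have "poly a (cis (2 * \<theta>)) + poly h (cis (2 * \<theta>)) * (cis (2 * \<theta>) * of_real \<tau>) = 1 + of_real e * X \<theta> \<tau>"
      by (simp add: a_def h_def X_def algebra_simps)
    ultimately show ?thesis by simp
  qed
  moreover have "coeff h 0 = 0" by (simp add: h_def h1_0)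
  moreover have "norm (coeff a 0) > 1"
  proof -
    have "coeff a 0 = of_real (1 + e * e0)" by (simp add: a_def B_0)
    then show ?thesis using e e0 by (simp only: norm_of_real) simp
  qed
  ultimately show ?thesis by blast
qed

section \<open>Uniqueness\<close>

definition cplx :: "real^2 \<Rightarrow> complex" where
  "cplx x = Complex (x $ 1) (x $ 2)"

lemma continuous_on_cplx [continuous_intros]: "continuous_on A cplx"
  unfolding cplx_def Complex_eq by (intro continuous_intros)

lemma integral_norm_bound_integral_AE:
  fixes f :: "'a \<Rightarrow> 'b :: {banach, second_countable_topology}"
  assumes "integrable M f" "integrable M g" "AE x in M. norm (f x) \<le> g x"
  shows "norm (integral\<^sup>L M f) \<le> integral\<^sup>L M g"
  using assms by (intro order.trans[OF integral_norm_bound] integral_mono_AE) auto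

definition square_supported :: "real \<Rightarrow> (real^2 \<Rightarrow> complex) \<Rightarrow> bool" where
  "square_supported \<kappa> u \<longleftrightarrow>
     integrable lborel u \<and> (AE x in lborel. (\<forall>i. \<bar>x $ i\<bar> \<le> \<kappa>) \<or> u x = 0)"

lemma square_supported_mult:
  assumes u: "square_supported \<kappa> u" and f: "continuous_on UNIV f"
  shows "square_supported \<kappa> (\<lambda>x. u x * f x)"
proof -
  define K :: "(real^2) set" where "K = cbox (\<chi> i. - \<kappa>) (\<chi> i. \<kappa>)"
  have K: "x \<in> K \<longleftrightarrow> (\<forall>i. \<bar>x $ i\<bar> \<le> \<kappa>)" for x
    by (auto simp: K_def mem_box_cart abs_le_iff minus_le_iff)
  have "bounded (f ` K)"
    using f unfolding K_def
    by (intro compact_imp_bounded compact_continuous_image) (auto intro: continuous_on_subset)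
  then obtain B where B: "B > 0" "\<And>x. x \<in> K \<Longrightarrow> norm (f x) \<le> B"
    by (auto simp: bounded_pos)
  have "integrable lborel (\<lambda>x. u x * f x)"
  proof (rule Bochner_Integration.integrable_bound)
    show "integrable lborel (\<lambda>x. of_real B * u x)"
      using u by (auto simp: square_supported_def)
    have "f \<in> borel_measurable lborel"
      using f by (simp add: borel_measurable_continuous_onI)
    then show "(\<lambda>x. u x * f x) \<in> borel_measurable lborel"
      using u by (auto simp: square_supported_def intro!: borel_measurable_times)
    have "AE x in lborel. x \<in> K \<or> u x = 0"
      using u by (simp add: square_supported_def K)
    then show "AE x in lborel. norm (u x * f x) \<le> norm (of_real B * u x)"
    proof eventually_elim
      case (elim x)
      then show ?case
        using mult_right_mono[OF B(2)[of x], of "norm (u x)"] B(1)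
        by (cases "u x = 0") (simp_all add: norm_mult mult.commute)
    qed
  qed
  then show ?thesis
    using u by (auto simp: square_supported_def elim: eventually_mono)
qed

lemma square_supported_integrable_mult:
  "square_supported \<kappa> u \<Longrightarrow> continuous_on UNIV f \<Longrightarrow> integrable lborel (\<lambda>x. u x * f x)"
  using square_supported_mult by (auto simp: square_supported_def)

text \<open>Moments against powers of the complex coordinate and its conjugate: up to binomial
  factors they are the coefficients of \<open>moment_poly\<close>.\<close>

definition moment :: "(real^2 \<Rightarrow> complex) \<Rightarrow> nat \<Rightarrow> nat \<Rightarrow> complex" where
  "moment u i j = (LINT x|lborel. u x * (cplx x ^ i * cnj (cplx x) ^ j))"

text \<open>On the circle, with \<open>\<zeta> = cis (2 * \<theta>)\<close>, the value of \<open>moment_poly u k\<close> at \<open>\<zeta>\<close>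
  is the \<open>k\<close>-th moment of the Radon data in direction \<open>\<theta>\<close>, times \<open>cis (k * \<theta>)\<close>.\<close>

definition moment_poly :: "(real^2 \<Rightarrow> complex) \<Rightarrow> nat \<Rightarrow> complex poly" where
  "moment_poly u k = (\<Sum>j\<le>k. monom (of_real (real (k choose j) / 2 ^ k) * moment u (k - j) j) j)"

text \<open>The function \<open>Y\<close>, affine in \<open>z\<close>, so that its moments are
  polynomials in \<open>z\<close>. On the circle it is a phase times the offset of
  \<open>x\<close>.\<close>

definition shear :: "complex \<Rightarrow> real^2 \<Rightarrow> complex" where
  "shear z x = (cplx x + cnj (cplx x) * z) / 2"

lemma continuous_on_shear [continuous_intros]: "continuous_on A (shear z)"
  unfolding shear_def by (intro continuous_intros) auto

lemma poly_moment_poly: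
  assumes "square_supported \<kappa> u"
  shows "poly (moment_poly u k) z = (LINT x|lborel. u x * shear z x ^ k)"
proof -
  have I: "integrable lborel (\<lambda>x. u x * (cplx x ^ i * cnj (cplx x) ^ j))" for i j
    by (intro square_supported_integrable_mult[OF assms] continuous_intros)
  have "u x * shear z x ^ k =
      (\<Sum>j\<le>k. (of_real (real (k choose j) / 2 ^ k) * z ^ j) * (u x * (cplx x ^ (k - j) * cnj (cplx x) ^ j)))" for x
    unfolding shear_def power_divide add.commute[of "cplx x"] binomial_ring
    by (simp add: sum_distrib_left sum_divide_distrib power_mult_distrib mult_ac)
  then have "(LINT x|lborel. u x * shear z x ^ k) =
      (\<Sum>j\<le>k. (of_real (real (k choose j) / 2 ^ k) * z ^ j) * moment u (k - j) j)"
    using I by (simp add: Bochner_Integration.integral_sum moment_def)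
  then show ?thesis
    by (simp add: moment_poly_def poly_sum poly_monom mult_ac)
qed

text \<open>By linearity each step multiplies the integrand by
  \<open>poly a z + poly h z * (shear z x)^2\<close>. The induction keeps \<open>k\<close> arbitrary
  because the step at \<open>k\<close> also uses the iterate at \<open>k + 2\<close>.\<close>

lemma poly_moment_step_iterate:
  assumes "square_supported \<kappa> u"
  shows "poly ((moment_step a h ^^ N) (moment_poly u) k) z =
    (LINT x|lborel. u x * ((poly a z + poly h z * (shear z x)\<^sup>2) ^ N * shear z x ^ k))"
proof (induction N arbitrary: k)
  case 0
  then show ?case using poly_moment_poly[OF assms] by simp
next
  case (Suc N)
  have I: "integrable lborel (\<lambda>x. u x * ((poly a z + poly h z * (shear z x)\<^sup>2) ^ N * shear z x ^ k))" for k
    by (intro square_supported_integrable_mult[OF assms] continuous_intros)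
  have "u x * ((poly a z + poly h z * (shear z x)\<^sup>2) ^ Suc N * shear z x ^ k) =
     poly a z * (u x * ((poly a z + poly h z * (shear z x)\<^sup>2) ^ N * shear z x ^ k)) +
     poly h z * (u x * ((poly a z + poly h z * (shear z x)\<^sup>2) ^ N * shear z x ^ (k + 2)))" for x
    by (simp add: algebra_simps power2_eq_square)
  then have "(LINT x|lborel. u x * ((poly a z + poly h z * (shear z x)\<^sup>2) ^ Suc N * shear z x ^ k)) =
     poly a z * (LINT x|lborel. u x * ((poly a z + poly h z * (shear z x)\<^sup>2) ^ N * shear z x ^ k)) +
     poly h z * (LINT x|lborel. u x * ((poly a z + poly h z * (shear z x)\<^sup>2) ^ N * shear z x ^ (k + 2)))"
    using I[of k] I[of "k + 2"] by (simp only: Bochner_Integration.integral_add integrable_mult_right integral_mult_right_zero)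
  then show ?case
    by (simp only: funpow.simps(2) o_apply poly_add poly_mult Suc.IH
        moment_step_def[where M = "(moment_step a h ^^ N) (moment_poly u)"])
qed

lemma nonpos_if_le_mult:
  fixes n C :: real
  assumes le: "\<And>e. e > 0 \<Longrightarrow> n \<le> e * C" and C: "C \<ge> 0"
  shows "n \<le> 0"
proof (rule ccontr)
  assume "\<not> n \<le> 0"
  then have n: "n > 0" by simp
  have "n \<le> n / (C + 1) * C"
    using n C by (intro le) auto
  then have "n * (C + 1) \<le> n * C"
    using C by (simp add: field_simps)
  then show False using n by (simp add: distrib_left)
qed

section \<open>Determinacy of moments on a square\<close>

text \<open>Orthogonality passes from monomials to real polynomials, by Stone-Weierstrass to
  continuous functions, by dominated convergence to indicators of closed sets, and by a Dynkin
  argument to all Borel sets.\<close>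

lemma moment_zero_imp_AE_zero:
  assumes u: "square_supported \<kappa> u" and mom: "\<And>i j. moment u i j = 0"
  shows "AE x in lborel. u x = 0"
proof -
  \<comment> \<open>Quantifying over all such \<open>v\<close> makes the set of admissible multipliers closed under products.\<close>
  define G where "G v \<longleftrightarrow> square_supported \<kappa> v \<and> (\<forall>i j. moment v i j = 0)" for v
  have G_mult: "\<forall>v. G v \<longrightarrow> G (\<lambda>x. v x * of_real (p x))" if "real_polynomial_function p" for p
    using that
  proof (induction rule: real_polynomial_function.induct)
    case (linear f)
    show ?case
    proof (intro allI impI)
      fix v assume v: "G v"
      have f: "f x = f (axis 1 1) * x $ 1 + f (axis 2 1) * x $ 2" for x
      proof -
        have "x = x $ 1 *\<^sub>R axis 1 1 + x $ 2 *\<^sub>R axis 2 1"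
          by (simp add: vec_eq_iff forall_2 axis_def)
        then have "f x = f (x $ 1 *\<^sub>R axis 1 1 + x $ 2 *\<^sub>R axis 2 1)" by simp
        then show ?thesis
          using linear by (simp add: bounded_linear.linear linear_add linear_scale mult.commute)
      qed
      \<comment> \<open>A real linear form is \<open>\<alpha> * z + cnj \<alpha> * cnj z\<close> in
        the complex coordinate, so multiplying by it only shifts moments.\<close>
      define \<alpha> where "\<alpha> = Complex (f (axis 1 1)) (- f (axis 2 1)) / 2"
      have f_eq: "complex_of_real (f x) = \<alpha> * cplx x + cnj \<alpha> * cnj (cplx x)" for x
        by (simp add: f[of x] \<alpha>_def cplx_def complex_eq_iff field_simps)
      have cont: "continuous_on UNIV (\<lambda>x. complex_of_real (f x))"
        using linear by (intro continuous_intros linear_continuous_on)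
      have I: "integrable lborel (\<lambda>x. v x * (cplx x ^ i * cnj (cplx x) ^ j))" for i j
        using v unfolding G_def by (intro square_supported_integrable_mult[of \<kappa> v] continuous_intros) auto
      have "moment (\<lambda>x. v x * of_real (f x)) i j = \<alpha> * moment v (Suc i) j + cnj \<alpha> * moment v i (Suc j)" for i j
      proof -
        have "v x * of_real (f x) * (cplx x ^ i * cnj (cplx x) ^ j) =
            \<alpha> * (v x * (cplx x ^ Suc i * cnj (cplx x) ^ j)) + cnj \<alpha> * (v x * (cplx x ^ i * cnj (cplx x) ^ Suc j))" for x
          by (simp add: f_eq algebra_simps)
        then show ?thesis
          using I[of "Suc i" j] I[of i "Suc j"] unfolding moment_def
          by (simp only: Bochner_Integration.integral_add integrable_mult_right integral_mult_right_zero)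
      qed
      then show "G (\<lambda>x. v x * of_real (f x))"
        using v cont square_supported_mult by (simp add: G_def)
    qed
  next
    case (const c)
    have "moment (\<lambda>x. v x * of_real c) i j = of_real c * moment v i j" for v i j
      by (simp add: moment_def mult_ac flip: integral_mult_right_zero)
    then show ?case
      using square_supported_mult[of \<kappa> _ "\<lambda>x. of_real c"] by (auto simp: G_def)
  next
    case (add f g)
    show ?case
    proof (intro allI impI)
      fix v assume "G v"
      then have fg: "G (\<lambda>x. v x * of_real (f x))" "G (\<lambda>x. v x * of_real (g x))"
        using add.IH by auto
      have I: "integrable lborel (\<lambda>x. w x * (cplx x ^ i * cnj (cplx x) ^ j))" if "G w" for w i j
        using that unfolding G_def by (intro square_supported_integrable_mult[of \<kappa> w] continuous_intros) auto
      have "moment (\<lambda>x. v x * of_real (f x + g x)) i j =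
          moment (\<lambda>x. v x * of_real (f x)) i j + moment (\<lambda>x. v x * of_real (g x)) i j" for i j
        using I[OF fg(1), of i j] I[OF fg(2), of i j]
        by (simp add: moment_def distrib_left distrib_right)
      then show "G (\<lambda>x. v x * of_real (f x + g x))"
        using fg by (auto simp: G_def square_supported_def distrib_left elim: eventually_elim2)
    qed
  next
    case (mult f g)
    then show ?case by (auto simp: mult.assoc[symmetric])
  qed
  define K :: "(real^2) set" where "K = cbox (\<chi> i. - \<kappa>) (\<chi> i. \<kappa>)"
  have K: "x \<in> K \<longleftrightarrow> (\<forall>i. \<bar>x $ i\<bar> \<le> \<kappa>)" for x
    by (auto simp: K_def mem_box_cart abs_le_iff minus_le_iff)
  have uK: "AE x in lborel. x \<in> K \<or> u x = 0" and ui: "integrable lborel u"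
    using u by (simp_all add: square_supported_def K)
  have um: "u \<in> borel_measurable borel" using ui by simp
  have "G u" using u mom by (simp add: G_def)
  have poly0: "(LINT x|lborel. u x * of_real (p x)) = 0" if "real_polynomial_function p" for p
  proof -
    have "moment (\<lambda>x. u x * of_real (p x)) 0 0 = 0"
      using G_mult[OF that] \<open>G u\<close> by (auto simp: G_def)
    then show ?thesis by (simp add: moment_def)
  qed
  have cont0: "(LINT x|lborel. u x * of_real (f x)) = 0" if f: "continuous_on UNIV f" for f :: "real^2 \<Rightarrow> real"
  proof -
    define C where "C = (LINT x|lborel. norm (u x))"
    have "norm (LINT x|lborel. u x * of_real (f x)) \<le> e * C" if "e > 0" for e
    proof -
      obtain p where p: "real_polynomial_function p" "\<And>x. x \<in> K \<Longrightarrow> \<bar>f x - p x\<bar> < e"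
        using Stone_Weierstrass_real_polynomial_function[of K f e] f \<open>e > 0\<close>
        by (auto simp: K_def intro: continuous_on_subset)
      have cp: "continuous_on UNIV p"
        using p(1) by (simp add: continuous_on_polymonial_function real_polynomial_function_eq)
      have I1: "integrable lborel (\<lambda>x. u x * of_real (f x))" "integrable lborel (\<lambda>x. u x * of_real (p x))"
        using f cp by (auto intro!: square_supported_integrable_mult[OF u] continuous_intros)
      have "(LINT x|lborel. u x * of_real (f x)) = (LINT x|lborel. u x * of_real (f x) - u x * of_real (p x))"
        using I1 poly0[OF p(1)] by simp
      also have "norm \<dots> \<le> (LINT x|lborel. e * norm (u x))"
      proof (rule integral_norm_bound_integral_AE)
        show "integrable lborel (\<lambda>x. u x * of_real (f x) - u x * of_real (p x))"
          using I1 by simp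
        show "integrable lborel (\<lambda>x. e * norm (u x))" using ui by simp
        show "AE x in lborel. norm (u x * of_real (f x) - u x * of_real (p x)) \<le> e * norm (u x)"
          using uK
        proof eventually_elim
          case (elim x)
          have "norm (u x * of_real (f x) - u x * of_real (p x)) = norm (u x) * \<bar>f x - p x\<bar>"
            by (simp add: norm_mult flip: right_diff_distrib of_real_diff)
          then show ?case
            using elim p(2)[of x] by (cases "u x = 0") (auto simp: mult.commute[of e] intro!: mult_left_mono)
        qed
      qed
      finally show ?thesis by (simp add: C_def)
    qed
    moreover have "C \<ge> 0" by (simp add: C_def)
    ultimately have "norm (LINT x|lborel. u x * of_real (f x)) \<le> 0"
      by (rule nonpos_if_le_mult)
    then show ?thesis by simp
  qed
  have closed0: "(LINT x:A|lborel. u x) = 0" if "closed A" for A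
  proof (cases "A = {}")
    case False
    \<comment> \<open>Continuous cutoffs decreasing to the indicator of \<open>A\<close>; off the
      closed nonempty set \<open>A\<close> the distance is positive, so they are eventually 0
      there.\<close>
    define f where "f n x = max 0 (1 - real n * infdist x A)" for n x
    have "(\<lambda>n. LINT x|lborel. u x * of_real (f n x)) \<longlonglongrightarrow> (LINT x|lborel. indicator A x *\<^sub>R u x)"
    proof (rule integral_dominated_convergence)
      have "f n \<in> borel_measurable borel" for n
        unfolding f_def by (intro borel_measurable_continuous_onI continuous_intros)
      then show "(\<lambda>x. u x * of_real (f n x)) \<in> borel_measurable lborel" for n
        using um by (intro borel_measurable_times) auto
      show "(\<lambda>x. indicator A x *\<^sub>R u x) \<in> borel_measurable lborel"
        using um that by auto
      show "integrable lborel (\<lambda>x. norm (u x))" using ui by simp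
      show "AE x in lborel. norm (u x * of_real (f n x)) \<le> norm (u x)" for n
        by (intro AE_I2) (simp add: norm_mult f_def mult_left_le infdist_nonneg)
      show "AE x in lborel. (\<lambda>n. u x * of_real (f n x)) \<longlonglongrightarrow> indicator A x *\<^sub>R u x"
      proof (rule AE_I2)
        fix x
        have "(\<lambda>n. f n x) \<longlonglongrightarrow> indicator A x"
        proof (cases "x \<in> A")
          case True
          then show ?thesis by (simp add: f_def)
        next
          case False
          then have "infdist x A > 0"
            using \<open>closed A\<close> \<open>A \<noteq> {}\<close> by (metis in_closed_iff_infdist_zero infdist_nonneg less_eq_real_def)
          then obtain N where N: "1 < real N * infdist x A"
            using reals_Archimedean3 by blast
          have "f n x = 0" if "n \<ge> N" for n
          proof -
            have "real N * infdist x A \<le> real n * infdist x A"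
              using that by (intro mult_right_mono infdist_nonneg) auto
            then show ?thesis using N by (simp add: f_def)
          qed
          then have "eventually (\<lambda>n. f n x = 0) sequentially"
            by (auto simp: eventually_sequentially)
          then show ?thesis using False by (simp add: tendsto_eventually)
        qed
        then have "(\<lambda>n. u x * of_real (f n x)) \<longlonglongrightarrow> u x * of_real (indicator A x)"
          by (intro tendsto_intros)
        then show "(\<lambda>n. u x * of_real (f n x)) \<longlonglongrightarrow> indicator A x *\<^sub>R u x"
          by (cases "x \<in> A") simp_all
      qed
    qed
    moreover have "(LINT x|lborel. u x * of_real (f n x)) = 0" for n
      unfolding f_def by (intro cont0 continuous_intros)
    ultimately show ?thesis
      by (simp add: LIMSEQ_const_iff set_lebesgue_integral_def)
  qed (simp add: set_lebesgue_integral_def)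
  have "(LINT x:A|lborel. u x) = 0" if "A \<in> sets lborel" for A
  proof -
    \<comment> \<open>The closed sets are an intersection-stable generator of the Borel sets, as the
      induction over disjoint unions and complements requires.\<close>
    have "Int_stable {S :: (real^2) set. closed S}" "{S :: (real^2) set. closed S} \<subseteq> Pow UNIV"
      by (auto simp: Int_stable_def)
    moreover have "A \<in> sigma_sets UNIV {S :: (real^2) set. closed S}"
      using that by (simp add: borel_eq_closed)
    ultimately show ?thesis
    proof (induction rule: sigma_sets_induct_disjoint)
      case (basic A)
      then show ?case using closed0 by auto
    next
      case empty
      then show ?case by (simp add: set_lebesgue_integral_def)
    next
      case (compl A)
      have A: "A \<in> sets lborel"
        using compl by (simp add: borel_eq_closed)
      have "(LINT x:UNIV - A|lborel. u x) = (LINT x|lborel. u x - indicator A x *\<^sub>R u x)"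
        unfolding set_lebesgue_integral_def
        by (intro Bochner_Integration.integral_cong) (auto simp: indicator_def)
      also have "\<dots> = (LINT x|lborel. u x) - (LINT x:A|lborel. u x)"
        using ui A unfolding set_lebesgue_integral_def
        by (intro Bochner_Integration.integral_diff integrable_mult_indicator) auto
      also have "\<dots> = 0"
        using closed0[of UNIV] compl by (simp add: set_lebesgue_integral_def)
      finally show ?case .
    next
      case (union A)
      have A: "A i \<in> sets lborel" for i
        using union by (auto simp: borel_eq_closed)
      have "(LINT x:(\<Union>i. A i)|lborel. u x) = (\<Sum>i. LINT x:A i|lborel. u x)"
        using A union ui
        by (intro lebesgue_integral_countable_add)
          (auto simp: disjoint_family_on_def set_integrable_def intro!: integrable_mult_indicator)
      then show ?case using union by simp
    qed
  qed
  then show ?thesis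
    using ui by (intro sigma_finite_measure.density_zero[OF sigma_finite_lborel])
qed

section \<open>From Radon data to uniform bounds on moments\<close>

text \<open>The squared support function of the unit square in direction \<open>\<theta>\<close>; it
  supplies both ends of the range of \<open>p^2\<close>.\<close>

lemma square_abs_cos_add_abs_sin: "(\<bar>cos \<theta>\<bar> + \<bar>sin \<theta>\<bar>)\<^sup>2 = 1 + \<bar>sin (2 * \<theta>)\<bar>" for \<theta> :: real
  by (simp add: power2_sum sin_double abs_mult)

lemma shear_cis: "shear (cis (2 * \<theta>)) x = cis \<theta> * of_real (x \<bullet> circle_point \<theta>)"
proof -
  have "sin \<theta> * sin \<theta> + cos \<theta> * cos \<theta> = 1"
    using sin_cos_squared_add[of \<theta>] by (simp add: power2_eq_square)
  moreover have "(cos \<theta>)\<^sup>2 = cos \<theta> * cos \<theta>" "(sin \<theta>)\<^sup>2 = sin \<theta> * sin \<theta>"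
    by (simp_all add: power2_eq_square)
  ultimately show ?thesis
    unfolding shear_def complex_eq_iff
    by (simp add: cplx_def circle_point_def inner_vec2 cos_double sin_double) algebra
qed

text \<open>Fubini turns the iterate into an integral of the Radon data against \<open>F\<close>.
  Where the data is nonzero, \<open>p^2\<close> lies in the interval of the separating property, so
  the \<open>N\<close>-th power has norm at most 1, and \<open>\<bar>p\<bar> \<le> 2\<close> bounds
  the remaining factor. The bound is independent of \<open>N\<close> and
  \<open>\<theta>\<close>.\<close>

lemma norm_moment_step_iterate_le:
  assumes u: "square_supported \<kappa> u" and \<kappa>: "0 \<le> \<kappa>" "\<kappa> < 1" and \<delta>: "1 \<le> 2 * \<delta>\<^sup>2" "\<delta> > 0"
    and rad: "AE p in lborel. line (circle_point \<theta>) p \<inter> open_square \<delta> \<noteq> {} \<longrightarrow> radon u (circle_point \<theta>) p = 0"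
    and ah: "\<And>\<tau>. (1 + \<bar>sin (2 * \<theta>)\<bar>) / 2 \<le> \<tau> \<Longrightarrow> \<tau> \<le> \<kappa>\<^sup>2 * (1 + \<bar>sin (2 * \<theta>)\<bar>) \<Longrightarrow>
      norm (poly a (cis (2 * \<theta>)) + poly h (cis (2 * \<theta>)) * (cis (2 * \<theta>) * of_real \<tau>)) \<le> 1"
  shows "norm (poly ((moment_step a h ^^ N) (moment_poly u) k) (cis (2 * \<theta>))) \<le> 2 ^ k * (LINT x|lborel. norm (u x))"
proof -
  define w where "w = circle_point \<theta>"
  define z where "z = cis (2 * \<theta>)"
  have w: "w \<in> sphere 0 1" unfolding w_def by (rule circle_point_in_sphere)
  have w12: "w $ 1 = cos \<theta>" "w $ 2 = sin \<theta>" by (simp_all add: w_def circle_point_def)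
  \<comment> \<open>On the circle the factor depends on \<open>x\<close> only through
    \<open>x \<bullet> w\<close>, so it is constant along each line and leaves the inner
    integral.\<close>
  define F where "F p = (poly a z + poly h z * (z * of_real (p\<^sup>2))) ^ N * (cis \<theta> * of_real p) ^ k" for p :: real
  have ui: "integrable lborel u" using u by (simp add: square_supported_def)
  have cis2: "(cis \<theta>)\<^sup>2 = z" by (simp add: z_def power2_eq_square cis_mult)
  have eq: "u x * ((poly a z + poly h z * (shear z x)\<^sup>2) ^ N * shear z x ^ k) = u x * F (x \<bullet> w)" for x
    unfolding z_def shear_cis by (simp add: F_def w_def power_mult_distrib cis2[unfolded z_def] z_def)
  have I: "integrable lborel (\<lambda>x. u x * F (x \<bullet> w))"
    unfolding eq[symmetric] by (intro square_supported_integrable_mult[OF u] continuous_intros)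
  have "poly ((moment_step a h ^^ N) (moment_poly u) k) z = (LINT x|lborel. u x * F (x \<bullet> w))"
    unfolding poly_moment_step_iterate[OF u] eq ..
  also have "\<dots> = (LINT p|lborel. LINT t|lborel. u (line_coords w (p, t)) * F p)"
    by (subst integral_line_coords[OF w I]) (simp add: line_coords_inner[OF w])
  also have "\<dots> = (LINT p|lborel. radon u w p * F p)"
    by (simp add: radon_def line_coords_def)
  also have "norm \<dots> \<le> (LINT p|lborel. 2 ^ k * (LINT t|lborel. norm (u (line_coords w (p, t)))))"
  proof (rule integral_norm_bound_integral_AE)
    have "integrable (lborel \<Otimes>\<^sub>M lborel) (\<lambda>z. u (line_coords w z) * F (line_coords w z \<bullet> w))"
      by (rule integrable_line_coords[OF w I])
    from lborel_pair.integrable_fst'[OF this]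
    show "integrable lborel (\<lambda>p. radon u w p * F p)"
      by (simp add: line_coords_inner[OF w]) (simp add: radon_def line_coords_def)
    show "integrable lborel (\<lambda>p. 2 ^ k * (LINT t|lborel. norm (u (line_coords w (p, t)))))"
      using lborel_pair.integrable_fst'[OF integrable_line_coords[OF w integrable_norm[OF ui]]]
      by simp
    \<comment> \<open>Lines that miss the square of half-side \<open>\<kappa>\<close> carry zero
      data, up to a null set of offsets.\<close>
    have "AE x in lborel. \<kappa> * (\<bar>cos \<theta>\<bar> + \<bar>sin \<theta>\<bar>) < \<bar>x \<bullet> w\<bar> \<longrightarrow> u x = 0"
      using u[unfolded square_supported_def, THEN conjunct2]
    proof eventually_elim
      case (elim x)
      have "\<bar>x \<bullet> w\<bar> \<le> \<kappa> * (\<bar>cos \<theta>\<bar> + \<bar>sin \<theta>\<bar>)" if "\<forall>i. \<bar>x $ i\<bar> \<le> \<kappa>"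
      proof -
        have "\<bar>x \<bullet> w\<bar> \<le> \<bar>x $ 1\<bar> * \<bar>cos \<theta>\<bar> + \<bar>x $ 2\<bar> * \<bar>sin \<theta>\<bar>"
          unfolding inner_vec2 w12 by (metis abs_mult abs_triangle_ineq)
        also have "\<dots> \<le> \<kappa> * \<bar>cos \<theta>\<bar> + \<kappa> * \<bar>sin \<theta>\<bar>"
          using that by (intro add_mono mult_right_mono) auto
        finally show ?thesis by (simp add: distrib_left)
      qed
      then show ?case using elim by auto
    qed
    from AE_line_coords[OF w this]
    have "AE p in lborel. AE t in lborel. \<kappa> * (\<bar>cos \<theta>\<bar> + \<bar>sin \<theta>\<bar>) < \<bar>p\<bar> \<longrightarrow> u (line_coords w (p, t)) = 0"
      by (simp add: line_coords_inner[OF w])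
    then have "AE p in lborel. \<kappa> * (\<bar>cos \<theta>\<bar> + \<bar>sin \<theta>\<bar>) < \<bar>p\<bar> \<longrightarrow> radon u w p = 0"
    proof eventually_elim
      case (elim p)
      show ?case
      proof
        assume "\<kappa> * (\<bar>cos \<theta>\<bar> + \<bar>sin \<theta>\<bar>) < \<bar>p\<bar>"
        with elim have "AE t in lborel. u (line_coords w (p, t)) = 0" by simp
        then show "radon u w p = 0"
          using integral_eq_zero_AE by (auto simp: radon_def line_coords_def)
      qed
    qed
    then show "AE p in lborel. norm (radon u w p * F p) \<le> 2 ^ k * (LINT t|lborel. norm (u (line_coords w (p, t))))"
      using rad
    proof eventually_elim
      case (elim p)
      show ?case
      proof (cases "radon u w p = 0")
        case True
        then show ?thesis by (simp add: integral_nonneg_AE)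
      next
        case False
        then have lo: "\<delta> * (\<bar>cos \<theta>\<bar> + \<bar>sin \<theta>\<bar>) \<le> \<bar>p\<bar>" and hi: "\<bar>p\<bar> \<le> \<kappa> * (\<bar>cos \<theta>\<bar> + \<bar>sin \<theta>\<bar>)"
          using elim line_meets_open_square[OF w, of p \<delta>] by (fastforce simp: w12 w_def[symmetric])+
        have "(\<delta> * (\<bar>cos \<theta>\<bar> + \<bar>sin \<theta>\<bar>))\<^sup>2 \<le> p\<^sup>2"
          using power_mono[OF lo, of 2] \<delta> by simp
        moreover have "1 / 2 * (1 + \<bar>sin (2 * \<theta>)\<bar>) \<le> \<delta>\<^sup>2 * (1 + \<bar>sin (2 * \<theta>)\<bar>)"
          using \<delta> by (intro mult_right_mono) auto
        ultimately have lo2: "(1 + \<bar>sin (2 * \<theta>)\<bar>) / 2 \<le> p\<^sup>2"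
          by (simp add: power_mult_distrib square_abs_cos_add_abs_sin)
        have hi2: "p\<^sup>2 \<le> \<kappa>\<^sup>2 * (1 + \<bar>sin (2 * \<theta>)\<bar>)"
          using power_mono[OF hi, of 2] by (simp add: power_mult_distrib square_abs_cos_add_abs_sin)
        have "\<bar>p\<bar> \<le> 1 * (1 + 1)"
          using \<kappa> by (intro order.trans[OF hi] mult_mono add_mono) auto
        then have "\<bar>p\<bar> ^ k \<le> 2 ^ k" by (intro power_mono) auto
        moreover have "norm (poly a z + poly h z * (z * of_real (p\<^sup>2))) ^ N \<le> 1"
          using ah[OF lo2 hi2] by (intro power_le_one) (auto simp: z_def)
        ultimately have "norm (F p) \<le> 1 * 2 ^ k"
          unfolding F_def norm_mult norm_power by (intro mult_mono) auto
        moreover have "norm (radon u w p) \<le> (LINT t|lborel. norm (u (line_coords w (p, t))))"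
          unfolding radon_def line_coords_def by simp
        ultimately show ?thesis
          unfolding norm_mult by (subst mult.commute) (intro mult_mono, auto)
      qed
    qed
  qed
  also have "\<dots> = 2 ^ k * (LINT x|lborel. norm (u x))"
    by (subst integral_line_coords[OF w, of "\<lambda>x. norm (u x)"]) (use ui in auto)
  finally show ?thesis by (simp add: z_def)
qed

text \<open>The set of angles violating the bound is open by continuity and null by assumption,
  hence empty.\<close>

lemma AE_circle_imp_all:
  fixes f :: "complex \<Rightarrow> real"
  assumes cont: "continuous_on UNIV f" and ae: "AE \<theta> in lborel. \<theta> \<in> {0..<2 * pi} \<longrightarrow> f (cis (2 * \<theta>)) \<le> C"
    and z: "norm z = 1"
  shows "f z \<le> C"
proof -
  \<comment> \<open>The angle 0 is an endpoint of the parameter interval; since the angle is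
    doubled, \<open>pi\<close> gives the same point and is interior.\<close>
  define \<theta> where "\<theta> = (if Arg2pi z = 0 then pi else Arg2pi z / 2)"
  have "z = cis (Arg2pi z)"
    using Arg2pi_eq[of z] z by (simp add: cis_conv_exp)
  then have zz: "z = cis (2 * \<theta>)"
    by (cases "Arg2pi z = 0") (simp_all add: \<theta>_def)
  have "0 \<le> Arg2pi z" "Arg2pi z < 2 * pi"
    by (simp_all add: Arg2pi_ge_0 Arg2pi_lt_2pi)
  then have \<theta>: "\<theta> \<in> {0<..<2 * pi}"
    by (auto simp: \<theta>_def)
  define S where "S = {0<..<2 * pi} \<inter> (\<lambda>\<theta>. f (cis (2 * \<theta>))) -` {C<..}"
  have "continuous_on UNIV (\<lambda>\<theta>. f (cis (2 * \<theta>)))"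
    by (intro continuous_on_compose2[OF cont] continuous_intros) auto
  then have "open S"
    unfolding S_def by (intro open_Int open_vimage) auto
  moreover have "S \<in> null_sets lborel"
    using ae \<open>open S\<close> by (subst AE_iff_null_sets) (auto simp: S_def elim!: eventually_mono)
  ultimately have "S = {}"
    using open_not_negligible negligible_iff_null_sets null_sets_completionI by blast
  then show ?thesis using \<theta> zz by (force simp: S_def)
qed

text \<open>The uniform bound holds for almost every direction, by continuity on the whole circle,
  and then the growth of the lowest coefficient excludes nonzero moments.\<close>

lemma AE_zero_if_radon_zero:
  assumes u: "integrable lborel u" and supp: "supp u \<Subset> open_square 1" and \<delta>: "1 \<le> 2 * \<delta>\<^sup>2" "\<delta> > 0"
    and rad: "AE (w, p) in arc_length_measure \<Otimes>\<^sub>M lborel. line w p \<inter> open_square \<delta> \<noteq> {} \<longrightarrow> radon u w p = 0"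
  shows "AE x in lborel. u x = 0"
proof -
  have "compact (closure (supp u))" "closure (supp u) \<subseteq> open_square 1"
    using supp by (auto simp: compactly_inside_def)
  then obtain \<kappa> where \<kappa>: "0 \<le> \<kappa>" "\<kappa> < 1" "\<And>x i. x \<in> closure (supp u) \<Longrightarrow> \<bar>x $ i\<bar> \<le> \<kappa>"
    using compact_in_open_square by blast
  have "AE x in lborel. (\<forall>i. \<bar>x $ i\<bar> \<le> \<kappa>) \<or> u x = 0"
    using AE_in_supp[of u] by eventually_elim (use \<kappa> closure_subset in blast)
  with u have ss: "square_supported \<kappa> u" by (simp add: square_supported_def)
  obtain a h where ah: "coeff h 0 = 0" "norm (coeff a 0) > 1"
    "\<And>\<theta> \<tau>. (1 + \<bar>sin (2 * \<theta>)\<bar>) / 2 \<le> \<tau> \<Longrightarrow> \<tau> \<le> \<kappa>\<^sup>2 * (1 + \<bar>sin (2 * \<theta>)\<bar>) \<Longrightarrow>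
      norm (poly a (cis (2 * \<theta>)) + poly h (cis (2 * \<theta>)) * (cis (2 * \<theta>) * of_real \<tau>)) \<le> 1"
    using exists_separating_poly_pair[OF \<kappa>(1,2)] by blast
  interpret arc: finite_measure arc_length_measure
  proof
    have "space arc_length_measure = sphere 0 1"
      by (simp add: arc_length_measure_def space_restrict_space)
    then show "emeasure arc_length_measure (space arc_length_measure) \<noteq> \<infinity>"
      by (simp add: emeasure_arc_length_measure)
  qed
  interpret pair_sigma_finite arc_length_measure lborel ..
  have "AE w in arc_length_measure. AE p in lborel. line w p \<inter> open_square \<delta> \<noteq> {} \<longrightarrow> radon u w p = 0"
    using AE_pair[OF rad] by simp
  then have "AE \<theta> in restrict_space lborel {0..<2 * pi}. AE p in lborel.
      line (circle_point \<theta>) p \<inter> open_square \<delta> \<noteq> {} \<longrightarrow> radon u (circle_point \<theta>) p = 0"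
    unfolding arc_length_measure_def by (rule AE_distrD[OF circle_point_measurable])
  then have ae: "AE \<theta> in lborel. \<theta> \<in> {0..<2 * pi} \<longrightarrow> (AE p in lborel.
      line (circle_point \<theta>) p \<inter> open_square \<delta> \<noteq> {} \<longrightarrow> radon u (circle_point \<theta>) p = 0)"
    by (subst (asm) AE_restrict_space_iff) auto
  have "norm (poly ((moment_step a h ^^ N) (moment_poly u) k) z) \<le> 2 ^ k * (LINT x|lborel. norm (u x))"
    if "norm z = 1" for N k z
  proof (rule AE_circle_imp_all[OF _ _ that])
    show "AE \<theta> in lborel. \<theta> \<in> {0..<2 * pi} \<longrightarrow>
        norm (poly ((moment_step a h ^^ N) (moment_poly u) k) (cis (2 * \<theta>))) \<le> 2 ^ k * (LINT x|lborel. norm (u x))"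
      using ae by eventually_elim
        (intro impI norm_moment_step_iterate_le[OF ss \<kappa>(1,2) \<delta> _ ah(3)], auto)
  qed (intro continuous_intros)
  then have mp: "moment_poly u k = 0" for k
    by (intro moment_step_bounded_imp_zero[OF ah(1,2)]) blast
  have "moment u i j = 0" for i j
  proof -
    \<comment> \<open>Each mixed moment appears alone in one coefficient, with a nonzero binomial
      factor.\<close>
    have "coeff (moment_poly u (i + j)) j = of_real (real ((i + j) choose j) / 2 ^ (i + j)) * moment u i j"
      by (simp add: moment_poly_def coeff_sum)
    then show ?thesis using mp by simp
  qed
  then show ?thesis by (rule moment_zero_imp_AE_zero[OF ss])
qed

section \<open>Smooth radial functions with vanishing interior data\<close>

lemma Ck_SucI:
  assumes "\<And>x. (f has_derivative D x) (at x)" and "\<And>v. Ck k (\<lambda>x. D x v)"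
  shows "Ck (Suc k) f"
proof -
  have "frechet_derivative f (at x) = D x" for x
    using frechet_derivative_at[OF assms(1)[of x]] by simp
  then show ?thesis using assms by (auto simp: differentiable_def)
qed

lemma Ck_SucD:
  assumes "Ck (Suc k) f"
  shows "(f has_derivative frechet_derivative f (at x)) (at x)"
    and "Ck k (\<lambda>x. frechet_derivative f (at x) v)"
  using assms by (auto simp: frechet_derivative_works)

lemma Ck_Suc_imp_Ck: "Ck (Suc k) f \<Longrightarrow> Ck k f"
proof (induction k arbitrary: f)
  case 0
  then show ?case
    by (auto intro!: continuous_at_imp_continuous_on differentiable_imp_continuous_within)
next
  case (Suc k)
  then show ?case by (metis Ck.simps(2))
qed

lemma Ck_const: "Ck k (\<lambda>x. c)"
proof (induction k arbitrary: c)
  case (Suc k)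
  show ?case by (rule Ck_SucI[where D = "\<lambda>x v. 0"]) (auto intro: Suc)
qed simp

lemma Ck_bounded_linear: "bounded_linear f \<Longrightarrow> Ck k f"
proof (cases k)
  case 0
  then show "bounded_linear f \<Longrightarrow> Ck k f" by (simp add: linear_continuous_on)
next
  case (Suc l)
  assume "bounded_linear f"
  then show "Ck k f"
    unfolding Suc by (intro Ck_SucI[where D = "\<lambda>x. f"] Ck_const) (auto simp: bounded_linear_imp_has_derivative)
qed

lemma Ck_add: "Ck k f \<Longrightarrow> Ck k g \<Longrightarrow> Ck k (\<lambda>x. f x + g x)"
proof (induction k arbitrary: f g)
  case 0
  then show ?case by (auto intro: continuous_on_add)
next
  case (Suc k)
  show ?case
    by (rule Ck_SucI) (rule has_derivative_add[OF Ck_SucD(1)[OF Suc.prems(1)] Ck_SucD(1)[OF Suc.prems(2)]],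
        intro Suc.IH Ck_SucD(2) Suc.prems)
qed

lemma Ck_mult:
  fixes f g :: "'a::euclidean_space \<Rightarrow> 'b::real_normed_algebra"
  shows "Ck k f \<Longrightarrow> Ck k g \<Longrightarrow> Ck k (\<lambda>x. f x * g x)"
proof (induction k arbitrary: f g)
  case 0
  then show ?case by (auto intro: continuous_on_mult)
next
  case (Suc k)
  show ?case
    by (rule Ck_SucI) (rule has_derivative_mult[OF Ck_SucD(1)[OF Suc.prems(1)] Ck_SucD(1)[OF Suc.prems(2)]],
        intro Ck_add Suc.IH Ck_SucD(2) Suc.prems Ck_Suc_imp_Ck)
qed

lemma Ck_imp_continuous: "Ck k f \<Longrightarrow> continuous_on UNIV f"
  by (induction k) (auto dest: Ck_Suc_imp_Ck simp del: Ck.simps(2))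

lemma smooth_real_derivative:
  fixes f :: "real \<Rightarrow> real"
  assumes "smooth f"
  obtains g where "smooth g" "\<And>x. (f has_real_derivative g x) (at x)"
proof
  show "smooth (\<lambda>x. frechet_derivative f (at x) 1)"
    using assms unfolding smooth_def by (blast intro: Ck_SucD(2))
  fix x
  have d: "(f has_derivative frechet_derivative f (at x)) (at x)"
    using assms unfolding smooth_def by (intro Ck_SucD(1)[of 0]) blast
  have "frechet_derivative f (at x) = (*) (frechet_derivative f (at x) 1)"
  proof
    fix v
    have "linear (frechet_derivative f (at x))"
      using d by (rule has_derivative_linear)
    from linear_scale[OF this, of v 1]
    show "frechet_derivative f (at x) v = frechet_derivative f (at x) 1 * v" by (simp add: mult.commute)
  qed
  with d show "(f has_real_derivative frechet_derivative f (at x) 1) (at x)"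
    by (simp add: has_field_derivative_def)
qed

section \<open>Flat functions, bumps and smoothness of radial integrals\<close>

definition flat :: "real poly \<Rightarrow> real \<Rightarrow> real" where
  "flat P x = (if x > 0 then poly P (1 / x) * exp (- (1 / x)) else 0)"

text \<open>From the right, \<open>y = 1 / x\<close> tends to infinity, where the exponential
  dominates every polynomial.\<close>

lemma flat_tendsto_0: "(flat P \<longlongrightarrow> 0) (at 0)"
proof -
  have "((\<lambda>y. \<Sum>i\<le>degree P. coeff P i * (y ^ i / exp y)) \<longlongrightarrow> (\<Sum>i\<le>degree P. coeff P i * 0)) at_top"
    by (intro tendsto_intros tendsto_power_div_exp_0)
  moreover have "(\<Sum>i\<le>degree P. coeff P i * (y ^ i / exp y)) = poly P y * exp (- y)" for y :: real
    by (simp add: poly_altdef sum_distrib_right exp_minus divide_inverse mult.assoc)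
  ultimately have "((\<lambda>y. poly P y * exp (- y)) \<longlongrightarrow> 0) at_top"
    by simp
  from filterlim_compose[OF this filterlim_inverse_at_top_right]
  have "((\<lambda>x. poly P (inverse x) * exp (- inverse x)) \<longlongrightarrow> 0) (at_right 0)" .
  then have "(flat P \<longlongrightarrow> 0) (at_right 0)"
    by (rule Lim_transform_eventually)
      (auto simp: eventually_at_filter flat_def divide_inverse)
  moreover have "(flat P \<longlongrightarrow> 0) (at_left 0)"
    by (rule tendsto_eventually) (auto simp: eventually_at_filter flat_def)
  ultimately show ?thesis by (simp add: filterlim_at_split)
qed

lemma DERIV_flat: "(flat P has_real_derivative flat ([:0, 0, 1:] * (P - pderiv P)) x) (at x)"
proof -
  consider "x > 0" | "x < 0" | "x = 0" by linarith
  then show ?thesis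
  proof cases
    case 1
    have "((\<lambda>x. poly P (1 / x) * exp (- (1 / x))) has_real_derivative flat ([:0, 0, 1:] * (P - pderiv P)) x) (at x)"
      using 1 by (auto intro!: derivative_eq_intros DERIV_chain2[OF poly_DERIV]
          simp: flat_def field_simps power2_eq_square)
    then show ?thesis
      by (rule has_field_derivative_transform_within_open[of _ _ _ "{0<..}"]) (use 1 in \<open>auto simp: flat_def\<close>)
  next
    case 2
    have "((\<lambda>x. 0) has_real_derivative flat ([:0, 0, 1:] * (P - pderiv P)) x) (at x)"
      using 2 by (simp add: flat_def)
    then show ?thesis
      by (rule has_field_derivative_transform_within_open[of _ _ _ "{..<0}"]) (use 2 in \<open>auto simp: flat_def\<close>)
  next
    case 3
    \<comment> \<open>The difference quotient at 0 is again of this form, the extra factor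
      \<open>1 / h\<close> being absorbed into the polynomial.\<close>
    have "flat P h / h = flat (pCons 0 P) h" for h
      by (simp add: flat_def)
    then show ?thesis
      using flat_tendsto_0[of "pCons 0 P"] 3 by (simp add: DERIV_def flat_def[of _ 0])
  qed
qed

text \<open>The induction runs over all \<open>P\<close>, since differentiation stays in the family.
  The affine argument covers both factors of \<open>bump\<close>.\<close>

lemma Ck_flat_affine: "Ck k (\<lambda>x. flat P (\<alpha> + \<beta> * x))"
proof (induction k arbitrary: P)
  case 0
  have "continuous_on UNIV (flat P)"
    using DERIV_flat by (auto intro!: continuous_at_imp_continuous_on DERIV_isCont)
  then show ?case
    by (auto intro!: continuous_on_compose2[of UNIV "flat P"] continuous_intros)
next
  case (Suc k)
  have "((\<lambda>x. flat P (\<alpha> + \<beta> * x)) has_real_derivative flat ([:0, 0, 1:] * (P - pderiv P)) (\<alpha> + \<beta> * x) * \<beta>) (at x)" for x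
    by (rule DERIV_chain2[OF DERIV_flat]) (auto intro!: derivative_eq_intros)
  then have "((\<lambda>x. flat P (\<alpha> + \<beta> * x)) has_derivative (\<lambda>v. flat ([:0, 0, 1:] * (P - pderiv P)) (\<alpha> + \<beta> * x) * \<beta> * v)) (at x)" for x
    by (simp add: has_field_derivative_def)
  then show ?case
    by (rule Ck_SucI) (intro Ck_mult Suc.IH Ck_const)
qed

definition bump :: "real \<Rightarrow> real \<Rightarrow> real \<Rightarrow> real" where
  "bump a c x = flat 1 (x - a) * flat 1 (c - x)"

lemma Ck_bump: "Ck k (bump a c)"
  using Ck_mult[OF Ck_flat_affine[of k 1 "- a" 1] Ck_flat_affine[of k 1 c "- 1"]]
  by (simp add: bump_def[abs_def])

lemma bump_nonneg: "0 \<le> bump a c x"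
  by (simp add: bump_def flat_def)

lemma bump_pos: "a < x \<Longrightarrow> x < c \<Longrightarrow> 0 < bump a c x"
  by (simp add: bump_def flat_def)

lemma bump_eq_0: "x \<le> a \<or> c \<le> x \<Longrightarrow> bump a c x = 0"
  by (auto simp: bump_def flat_def)

lemma integrable_continuous_compact_support:
  fixes f :: "'a::euclidean_space \<Rightarrow> 'b::euclidean_space"
  assumes "continuous_on UNIV f" "compact K" "\<And>x. x \<notin> K \<Longrightarrow> f x = 0"
  shows "integrable lborel f"
proof -
  have "integrable lborel (\<lambda>x. indicator K x *\<^sub>R f x)"
    using assms(1,2) by (intro borel_integrable_compact) (auto intro: continuous_on_subset)
  also have "(\<lambda>x. indicator K x *\<^sub>R f x) = f"
    using assms(3) by (auto simp: indicator_def)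
  finally show ?thesis .
qed

text \<open>The positive bump lies to the right, so the function is nonnegative from
  \<open>a + d\<close> on; this is what shows later that its radial integral is nonzero.\<close>

definition zero_mean_bump :: "real \<Rightarrow> real \<Rightarrow> real \<Rightarrow> real" where
  "zero_mean_bump a d x = bump (a + d) (a + 2 * d) x - bump a (a + d) x"

lemma smooth_zero_mean_bump: "smooth (zero_mean_bump a d)"
  unfolding smooth_def
proof
  fix k
  have "Ck k (\<lambda>x. bump (a + d) (a + 2 * d) x + (- 1) * bump a (a + d) x)"
    by (intro Ck_add Ck_mult Ck_const Ck_bump)
  then show "Ck k (zero_mean_bump a d)"
    by (simp add: zero_mean_bump_def[abs_def])
qed

lemma continuous_on_zero_mean_bump: "continuous_on A (zero_mean_bump a d)"
  using smooth_zero_mean_bump Ck.simps(1) unfolding smooth_def by (metis continuous_on_subset subset_UNIV)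

lemma zero_mean_bump_eq_0: "d \<ge> 0 \<Longrightarrow> x \<le> a \<or> a + 2 * d \<le> x \<Longrightarrow> zero_mean_bump a d x = 0"
  by (auto simp: zero_mean_bump_def bump_eq_0)

text \<open>The two bumps are translates of each other.\<close>

lemma integral_zero_mean_bump:
  assumes "d \<ge> 0"
  shows "(LINT x|lborel. zero_mean_bump a d x) = 0"
proof -
  have I: "integrable lborel (bump b c)" for b c
    using Ck_imp_continuous[OF Ck_bump]
    by (rule integrable_continuous_compact_support[of _ "{b..c}"]) (auto simp: bump_eq_0)
  have "bump (a + d) (a + 2 * d) x = bump a (a + d) (- d + 1 * x)" for x
    unfolding bump_def by (intro arg_cong2[where f = "(*)"] arg_cong[where f = "flat 1"]) auto
  then have "(LINT x|lborel. bump (a + d) (a + 2 * d) x) = (LINT x|lborel. bump a (a + d) x)"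
    using lborel_integral_real_affine[of 1 "bump a (a + d)" "- d"] by simp
  then show ?thesis
    using I by (simp add: zero_mean_bump_def)
qed

text \<open>For \<open>s \<ge> 0\<close> and \<open>f\<close> vanishing on \<open>{1..}\<close> this is the integral of \<open>x \<mapsto> f (x \<bullet> x)\<close>
  over a line at distance \<open>sqrt s\<close> from the origin.\<close>

definition abel :: "(real \<Rightarrow> real) \<Rightarrow> real \<Rightarrow> real" where
  "abel f s = integral {- 1..1} (\<lambda>t. f (s + t\<^sup>2))"

text \<open>The integration interval is fixed and compact, so differentiation under the integral
  sign applies without boundary terms.\<close>

lemma DERIV_abel:
  assumes "\<And>x. (f has_real_derivative g x) (at x)" and g: "continuous_on UNIV g"
  shows "(abel f has_real_derivative abel g s) (at s)"
proof -
  have f: "continuous_on UNIV f"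
    using assms(1) by (auto intro!: continuous_at_imp_continuous_on DERIV_isCont)
  have "((\<lambda>s. integral (cbox (- 1) 1) (\<lambda>t. f (s + t\<^sup>2))) has_field_derivative
      integral (cbox (- 1) 1) (\<lambda>t. g (s + t\<^sup>2))) (at s within UNIV)"
  proof (rule leibniz_rule_field_derivative)
    show "((\<lambda>x. f (x + t\<^sup>2)) has_field_derivative g (x + t\<^sup>2)) (at x within UNIV)" for x t
    proof -
      have "((\<lambda>x. x + t\<^sup>2) has_real_derivative 1) (at x)"
        by (auto intro!: derivative_eq_intros)
      from DERIV_chain2[OF assms(1) this] show ?thesis by simp
    qed
    show "(\<lambda>t. f (x + t\<^sup>2)) integrable_on cbox (- 1) 1" for x
      by (intro integrable_continuous continuous_on_compose2[OF f] continuous_intros) auto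
    show "continuous_on (UNIV \<times> cbox (- 1) 1) (\<lambda>(x, t). g (x + t\<^sup>2))"
      unfolding case_prod_beta by (intro continuous_on_compose2[OF g] continuous_intros) auto
  qed auto
  then show ?thesis by (simp add: abel_def[abs_def])
qed

text \<open>Differentiation turns \<open>abel f\<close> into \<open>abel g\<close>, with
  \<open>g\<close> the derivative of \<open>f\<close>, times a linear form; hence the induction over
  all smooth \<open>f\<close>.\<close>

lemma Ck_radial_abel: "smooth f \<Longrightarrow> Ck k (\<lambda>x :: real^2. complex_of_real (abel f (x \<bullet> x)))"
proof (induction k arbitrary: f)
  case 0
  obtain g where g: "smooth g" "\<And>x. (f has_real_derivative g x) (at x)"
    using smooth_real_derivative[OF 0] by blast
  have "continuous_on UNIV g" using g(1) by (auto simp: smooth_def dest: spec[where x = 0])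
  then have "continuous_on UNIV (abel f)"
    using DERIV_abel[OF g(2)] by (auto intro!: continuous_at_imp_continuous_on DERIV_isCont)
  then show ?case
    by (auto intro!: continuous_on_compose2[of UNIV "abel f"] continuous_intros)
next
  case (Suc k)
  obtain g where g: "smooth g" "\<And>x. (f has_real_derivative g x) (at x)"
    using smooth_real_derivative[OF Suc.prems] by blast
  have "continuous_on UNIV g" using g(1) by (auto simp: smooth_def dest: spec[where x = 0])
  then have D: "(abel f has_derivative (*) (abel g s)) (at s)" for s
    using DERIV_abel[OF g(2)] by (simp add: has_field_derivative_def)
  have "((\<lambda>x. complex_of_real (abel f (x \<bullet> x))) has_derivative
      (\<lambda>v. complex_of_real (abel g (x \<bullet> x)) * complex_of_real (2 * (x \<bullet> v)))) (at x)" for x :: "real^2"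
  proof -
    have "((\<lambda>x. x \<bullet> x) has_derivative (\<lambda>v. 2 * (x \<bullet> v))) (at x)"
      by (auto intro!: derivative_eq_intros simp: inner_commute)
    from has_derivative_compose[OF this D]
    have "((\<lambda>x. abel f (x \<bullet> x)) has_derivative (\<lambda>v. abel g (x \<bullet> x) * (2 * (x \<bullet> v)))) (at x)" .
    from has_derivative_of_real[OF this] show ?thesis by simp
  qed
  moreover have "bounded_linear (\<lambda>x. complex_of_real (2 * (x \<bullet> v)))" for v :: "real^2"
    by (intro bounded_linear_compose[OF bounded_linear_of_real] bounded_linear_const_mult bounded_linear_inner_left)
  ultimately show ?case
    by (rule Ck_SucI[OF _ Ck_mult[OF Suc.IH[OF g(1)] Ck_bounded_linear]])
qed

section \<open>Radon transforms of radial functions\<close>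

lemma abel_eq_lebesgue:
  assumes f: "continuous_on UNIV f" and "\<And>x. x \<ge> 1 \<Longrightarrow> f x = 0" and s: "s \<ge> 0"
  shows "abel f s = (LINT t|lborel. f (s + t\<^sup>2))"
proof -
  have c: "continuous_on A (\<lambda>t. f (s + t\<^sup>2))" for A
    by (intro continuous_on_compose2[OF f] continuous_intros) auto
  have "set_integrable lborel {- 1..1} (\<lambda>t. f (s + t\<^sup>2))"
    unfolding set_integrable_def by (intro borel_integrable_compact c) auto
  from set_borel_integral_eq_integral(2)[OF this]
  have "abel f s = (LINT t:{- 1..1}|lborel. f (s + t\<^sup>2))"
    by (simp add: abel_def)
  also have "\<dots> = (LINT t|lborel. f (s + t\<^sup>2))"
    unfolding set_lebesgue_integral_def
  proof (intro Bochner_Integration.integral_cong refl)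
    fix t :: real
    have "f (s + t\<^sup>2) = 0" if "t \<notin> {- 1..1}"
    proof -
      have "1 \<le> t\<^sup>2" using that by (intro one_le_power[of "\<bar>t\<bar>" 2, simplified]) auto
      then show ?thesis using s assms(2) by simp
    qed
    then show "indicator {- 1..1} t *\<^sub>R f (s + t\<^sup>2) = f (s + t\<^sup>2)"
      by (auto simp: indicator_def)
  qed
  finally show ?thesis .
qed

text \<open>A disc of squared radius \<open>r\<close> has area \<open>pi * r\<close>, so the squared
  norm has constant density \<open>pi\<close>. The sign is reversed so that the rays
  \<open>{x<..}\<close> used for comparison have finite measure.\<close>

lemma distr_minus_norm_square_plane:
  "distr lborel borel (\<lambda>z :: real \<times> real. - (norm z)\<^sup>2) = density lborel (\<lambda>v. ennreal (pi * indicator {..0} v))"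
  (is "?M = ?N")
proof (rule measure_eqI_lessThan)
  have M: "emeasure ?M {x<..} = ennreal (pi * max 0 (- x))" for x :: real
  proof -
    have "(\<lambda>z :: real \<times> real. - (norm z)\<^sup>2) -` {x<..} = (if x < 0 then ball 0 (sqrt (- x)) else {})"
    proof (cases "x < 0")
      case True
      have "x < - (norm z)\<^sup>2 \<longleftrightarrow> norm z < sqrt (- x)" for z :: "real \<times> real"
        using real_less_rsqrt[of "norm z" "- x"] real_sqrt_less_mono[of "(norm z)\<^sup>2" "- x"] True
        by (smt (verit) norm_ge_zero real_sqrt_abs real_sqrt_less_iff)
      then show ?thesis using True by auto
    next
      case False
      then show ?thesis by (auto simp: not_less) (smt (verit) zero_le_power2)
    qed
    then have "emeasure ?M {x<..} = emeasure lborel (if x < 0 then ball (0 :: real \<times> real) (sqrt (- x)) else {})"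
      by (subst emeasure_distr) auto
    also have "\<dots> = ennreal (pi * max 0 (- x))"
      by (auto simp: emeasure_ball unit_ball_vol_2)
    finally show ?thesis .
  qed
  show "emeasure ?M {x<..} < \<infinity>" for x by (simp add: M)
  show "emeasure ?M {x<..} = emeasure ?N {x<..}" for x
  proof -
    have "emeasure ?N {x<..} = (\<integral>\<^sup>+ v. ennreal (pi * indicator {..0} v) * indicator {x<..} v \<partial>lborel)"
      by (intro emeasure_density) auto
    also have "\<dots> = (\<integral>\<^sup>+ v. ennreal pi * indicator {x<..0} v \<partial>lborel)"
      by (intro nn_integral_cong) (auto simp: indicator_def)
    also have "\<dots> = ennreal (pi * max 0 (- x))"
      by (cases "x \<le> 0") (auto simp: nn_integral_cmult simp flip: ennreal_mult)
    finally show ?thesis by (simp add: M)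
  qed
qed auto

text \<open>The integral along the line and the one inside \<open>abel\<close> combine to a planar
  integral of \<open>f (p^2 + (norm z)^2)\<close>, that is, \<open>pi\<close> times the integral of
  \<open>f\<close> above \<open>p^2\<close>. As \<open>f\<close> vanishes up to \<open>a\<close>,
  nothing depends on \<open>p\<close>.\<close>

lemma radon_radial_abel:
  assumes w: "w \<in> sphere 0 1" and f: "continuous_on UNIV f"
    and lo: "\<And>x. x \<le> a \<Longrightarrow> f x = 0" and hi: "\<And>x. x \<ge> 1 \<Longrightarrow> f x = 0" and p: "p\<^sup>2 \<le> a"
  shows "radon (\<lambda>x. complex_of_real (abel f (x \<bullet> x))) w p = of_real (pi * (LINT x|lborel. f x))"
proof -
  have fm: "f \<in> borel_measurable borel" using f by (rule borel_measurable_continuous_onI)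
  define G where "G z = f (p\<^sup>2 + (norm z)\<^sup>2)" for z :: "real \<times> real"
  have G: "integrable (lborel \<Otimes>\<^sub>M lborel) G"
    unfolding lborel_prod
  proof (rule integrable_continuous_compact_support)
    show "continuous_on UNIV G"
      unfolding G_def by (intro continuous_on_compose2[OF f] continuous_intros) auto
    show "G z = 0" if "z \<notin> cball 0 1" for z
    proof -
      have "1 \<le> (norm z)\<^sup>2" using that by (intro one_le_power) auto
      then show ?thesis using hi[of "p\<^sup>2 + (norm z)\<^sup>2"] by (simp add: G_def add_increasing)
    qed
  qed simp
  have sq: "(p *\<^sub>R w + t *\<^sub>R perp w) \<bullet> (p *\<^sub>R w + t *\<^sub>R perp w) = p\<^sup>2 + t\<^sup>2" for t
  proof -
    have n: "w $ 1 * w $ 1 + w $ 2 * w $ 2 = 1"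
      using w unfolding sphere_vec2 by (simp add: power2_eq_square)
    then have "w \<bullet> w = 1" "perp w \<bullet> perp w = 1" "w \<bullet> perp w = 0" "perp w \<bullet> w = 0"
      by (simp_all add: inner_vec2 perp_components add.commute)
    then show ?thesis by (simp add: inner_left_distrib inner_right_distrib power2_eq_square)
  qed
  have "radon (\<lambda>x. complex_of_real (abel f (x \<bullet> x))) w p = of_real (LINT t|lborel. abel f (p\<^sup>2 + t\<^sup>2))"
    unfolding radon_def sq by (rule integral_complex_of_real)
  also have "(LINT t|lborel. abel f (p\<^sup>2 + t\<^sup>2)) = (LINT t|lborel. LINT s|lborel. G (t, s))"
    by (simp add: abel_eq_lebesgue[OF f hi] G_def norm_prod_def add.assoc)
  also have "\<dots> = (LINT z|lborel. G z)"
    using lborel_pair.integral_fst'[OF G] by (simp add: lborel_prod)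
  also have "\<dots> = (LINT v|distr lborel borel (\<lambda>z :: real \<times> real. - (norm z)\<^sup>2). f (p\<^sup>2 - v))"
    using fm by (subst integral_distr) (auto simp: G_def[abs_def])
  also have "\<dots> = (LINT v|lborel. (pi * indicator {..0} v) *\<^sub>R f (p\<^sup>2 - v))"
    unfolding distr_minus_norm_square_plane using fm by (intro integral_density) auto
  also have "\<dots> = (LINT v|lborel. pi * f (p\<^sup>2 + (- 1) * v))"
    using p lo by (intro Bochner_Integration.integral_cong) (auto simp: indicator_def)
  also have "\<dots> = pi * (LINT x|lborel. f x)"
    using lborel_integral_real_affine[of "- 1" f "p\<^sup>2"] by simp
  finally show ?thesis .
qed

lemma exists_smooth_radon_zero:
  assumes \<delta>: "\<delta> > 0" "2 * \<delta>\<^sup>2 < 1"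
  shows "\<exists>u \<in> Cc_infty (open_square 1). u \<noteq> (\<lambda>x. 0) \<and>
    (\<forall>w \<in> sphere 0 1. \<forall>p. line w p \<inter> open_square \<delta> \<noteq> {} \<longrightarrow> radon u w p = 0)"
proof -
  \<comment> \<open>\<open>a\<close> is the squared radius of the circle through the corners of the
    inner square, and \<open>a + 2 * d\<close> is the midpoint of \<open>a\<close> and 1, so the
    support stays in a disc of radius less than 1.\<close>
  define a where "a = 2 * \<delta>\<^sup>2"
  define d where "d = (1 - a) / 4"
  have a: "0 < a" "a < 1"
    using \<delta> by (auto simp: a_def)
  then have d: "d > 0" "a + 2 * d < 1"
    by (auto simp: d_def field_simps)
  define f where "f = zero_mean_bump a d"
  have f0: "f x = 0" if "x \<le> a \<or> a + 2 * d \<le> x" for x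
    using zero_mean_bump_eq_0[of d x a] d that by (simp add: f_def)
  have fc: "continuous_on A f" for A by (simp add: f_def continuous_on_zero_mean_bump)
  define u where "u x = complex_of_real (abel f (x \<bullet> x))" for x :: "real^2"
  have smooth_u: "smooth u"
    unfolding smooth_def u_def f_def by (intro allI Ck_radial_abel smooth_zero_mean_bump)
  have u0: "u x = 0" if "a + 2 * d \<le> x \<bullet> x" for x
  proof -
    have "abel f (x \<bullet> x) = integral {- 1..1} (\<lambda>t::real. 0)"
      unfolding abel_def using that by (intro integral_cong f0) (auto intro: add_increasing2)
    then show ?thesis by (simp add: u_def)
  qed
  have "supp u \<Subset> open_square 1"
  proof -
    have "{x. u x \<noteq> 0} \<subseteq> cball 0 (sqrt (a + 2 * d))"
    proof
      fix x assume "x \<in> {x. u x \<noteq> 0}"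
      then have "x \<bullet> x < a + 2 * d" using u0[of x] by (cases "a + 2 * d \<le> x \<bullet> x") auto
      then show "x \<in> cball 0 (sqrt (a + 2 * d))" by (simp add: norm_eq_sqrt_inner)
    qed
    moreover have "supp u = closure {x. u x \<noteq> 0}"
      using smooth_u unfolding smooth_def by (intro supp_continuous) (metis Ck.simps(1))
    ultimately have sub: "closure (supp u) \<subseteq> cball 0 (sqrt (a + 2 * d))"
      by (simp add: closure_minimal)
    have "sqrt (a + 2 * d) < 1" using d by simp
    then have "cball 0 (sqrt (a + 2 * d)) \<subseteq> open_square 1"
    proof (intro subsetI)
      fix x :: "real^2" assume "sqrt (a + 2 * d) < 1" "x \<in> cball 0 (sqrt (a + 2 * d))"
      then have "norm x < 1"
        by (metis dist_0_norm le_less_trans mem_cball)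
      then have "\<bar>x $ i\<bar> < 1" for i
        using component_le_norm_cart[of x i] by simp
      then show "x \<in> open_square 1"
        by (auto simp: open_square_def abs_less_iff minus_less_iff)
    qed
    with sub show ?thesis
      unfolding compactly_inside_def
      by (meson bounded_cball bounded_subset closed_closure compact_eq_bounded_closed subset_trans)
  qed
  then have "u \<in> Cc_infty (open_square 1)"
    using smooth_u by (simp add: Cc_infty_def)
  moreover have "u \<noteq> (\<lambda>x. 0)"
  proof
    assume "u = (\<lambda>x. 0)"
    \<comment> \<open>At squared radius \<open>a + d\<close> only the positive bump enters the
      integral, so no cancellation can occur.\<close>
    then have "u (sqrt (a + d) *\<^sub>R axis 1 1) = 0" by simp
    then have "abel f (a + d) = 0"
      using a d by (simp add: u_def inner_axis_axis)
    then have int0: "integral {- 1..1} (\<lambda>t. f (a + d + t\<^sup>2)) = 0" by (simp add: abel_def)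
    have feq: "f (a + d + t\<^sup>2) = bump (a + d) (a + 2 * d) (a + d + t\<^sup>2)" for t
      by (simp add: f_def zero_mean_bump_def bump_eq_0)
    have cont: "continuous_on {- 1..1} (\<lambda>t. f (a + d + t\<^sup>2))"
      by (intro continuous_on_compose2[OF fc] continuous_intros) auto
    have "\<forall>t\<in>{- 1..1}. f (a + d + t\<^sup>2) = 0"
      using int0 integral_eq_0_iff[OF cont] by (simp add: feq bump_nonneg)
    \<comment> \<open>At this \<open>t\<close> the argument \<open>a + d + t^2\<close> is the
      midpoint of the positive bump.\<close>
    moreover have "sqrt (d / 2) \<in> {- 1..1}"
      using d a by (auto intro: order.trans[of _ 0])
    moreover have "f (a + d + (sqrt (d / 2))\<^sup>2) > 0"
      unfolding feq using d by (intro bump_pos) auto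
    ultimately show False by fastforce
  qed
  moreover have "radon u w p = 0" if w: "w \<in> sphere 0 1" and meet: "line w p \<inter> open_square \<delta> \<noteq> {}" for w p
  proof -
    obtain x where x: "x \<bullet> w = p" "x \<in> open_square \<delta>"
      using meet by (auto simp: line_def)
    have xi: "(x $ i)\<^sup>2 \<le> \<delta>\<^sup>2" for i
      using x(2) by (intro power2_le_iff_abs_le[THEN iffD2]) (auto simp: open_square_def abs_le_iff minus_le_iff less_imp_le)
    \<comment> \<open>By Cauchy-Schwarz, a line meeting the inner square meets the disc through its
      corners.\<close>
    have "p\<^sup>2 \<le> (x \<bullet> x) * (w \<bullet> w)"
      using Cauchy_Schwarz_ineq[of x w] x(1) by simp
    also have "\<dots> = x \<bullet> x" using w by (simp add: dot_square_norm)
    also have "\<dots> \<le> a"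
      using xi[of 1] xi[of 2] by (simp add: inner_vec2 a_def power2_eq_square)
    finally have "p\<^sup>2 \<le> a" .
    then have "radon u w p = of_real (pi * (LINT x|lborel. f x))"
      unfolding u_def using d by (intro radon_radial_abel[OF w fc]) (auto intro: f0)
    then show ?thesis
      using integral_zero_mean_bump[of d a] d by (simp add: f_def)
  qed
  ultimately show ?thesis by blast
qed

section \<open>The equivalence\<close>

theorem corollary12:
  fixes \<delta> :: real and D D0 :: "(real^2) set"
  assumes "\<delta> > 0"
    and "D = open_square 1"
    and "D0 = open_square \<delta>"
  shows "((\<exists>u \<in> Cc_infty D. u \<noteq> (\<lambda>x. 0) \<and>
            (\<forall>w \<in> sphere 0 1. \<forall>p. line w p \<inter> D0 \<noteq> {} \<longrightarrow> radon u w p = 0))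
          \<longleftrightarrow> \<delta> < 1 / sqrt 2)
       \<and> ((\<exists>u. integrable lborel u \<and> supp u \<Subset> D \<and> \<not> (AE x in lborel. u x = 0) \<and>
            (AE (w, p) in arc_length_measure \<Otimes>\<^sub>M lborel.
               line w p \<inter> D0 \<noteq> {} \<longrightarrow> radon u w p = 0))
          \<longleftrightarrow> \<delta> < 1 / sqrt 2)"
proof -
  have c_iff: "\<delta> < 1 / sqrt 2 \<longleftrightarrow> 2 * \<delta>\<^sup>2 < 1"
  proof -
    have "\<delta> < 1 / sqrt 2 \<longleftrightarrow> sqrt 2 * \<delta> < 1"
      by (simp add: field_simps)
    also have "\<dots> \<longleftrightarrow> (sqrt 2 * \<delta>)\<^sup>2 < 1"
      using assms(1) by (simp add: abs_square_less_1)
    finally show ?thesis by (simp add: power_mult_distrib)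
  qed
  let ?a = "\<exists>u \<in> Cc_infty D. u \<noteq> (\<lambda>x. 0) \<and>
      (\<forall>w \<in> sphere 0 1. \<forall>p. line w p \<inter> D0 \<noteq> {} \<longrightarrow> radon u w p = 0)"
  let ?b = "\<exists>u. integrable lborel u \<and> supp u \<Subset> D \<and> \<not> (AE x in lborel. u x = 0) \<and>
      (AE (w, p) in arc_length_measure \<Otimes>\<^sub>M lborel. line w p \<inter> D0 \<noteq> {} \<longrightarrow> radon u w p = 0)"
  \<comment> \<open>Both equivalences follow from the cycle (c) to (a) to (b) to (c).\<close>
  have ca: "?a" if "\<delta> < 1 / sqrt 2"
    using exists_smooth_radon_zero[OF assms(1)] that assms(2,3) by (simp add: c_iff)
  have ab: "?b" if a: ?a
  proof -
    obtain u where u: "u \<in> Cc_infty D" "u \<noteq> (\<lambda>x. 0)"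
      and rad: "\<And>w p. w \<in> sphere 0 1 \<Longrightarrow> line w p \<inter> D0 \<noteq> {} \<Longrightarrow> radon u w p = 0"
      using a by blast
    have cont: "continuous_on UNIV u" and supp: "supp u \<Subset> D"
      using u(1) by (auto simp: Cc_infty_def smooth_def intro: Ck_imp_continuous)
    have supp_eq: "supp u = closure {x. u x \<noteq> 0}"
      by (rule supp_continuous[OF cont])
    have "integrable lborel u"
      using cont
    proof (rule integrable_continuous_compact_support)
      show "compact (closure (supp u))" using supp by (simp add: compactly_inside_def)
      show "u x = 0" if "x \<notin> closure (supp u)" for x
        using that closure_subset[of "{x. u x \<noteq> 0}"] by (auto simp: supp_eq)
    qed
    \<comment> \<open>If \<open>u\<close> vanished almost everywhere, the whole plane would be
      removed in \<open>supp u\<close>; but for continuous \<open>u\<close> this set contains every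
      point where \<open>u\<close> is nonzero.\<close>
    moreover have "\<not> (AE x in lborel. u x = 0)"
    proof
      assume "AE x in lborel. u x = 0"
      then have "supp u = {}" by (auto simp: supp_def)
      then show False using u(2) by (auto simp: supp_eq)
    qed
    moreover have "AE (w, p) in arc_length_measure \<Otimes>\<^sub>M lborel. line w p \<inter> D0 \<noteq> {} \<longrightarrow> radon u w p = 0"
      by (intro AE_I2) (auto simp: space_pair_measure arc_length_measure_def space_restrict_space intro!: rad)
    ultimately show ?thesis using supp by blast
  qed
  have bc: "\<delta> < 1 / sqrt 2" if ?b
  proof (rule ccontr)
    assume "\<not> \<delta> < 1 / sqrt 2"
    then have "1 \<le> 2 * \<delta>\<^sup>2" by (simp add: c_iff)
    then show False
      using that AE_zero_if_radon_zero[OF _ _ _ assms(1)] unfolding assms(2,3) by blast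
  qed
  from ca ab bc show ?thesis by blast
qed

end
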